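(* Let $m\ge 2$ be an integer with $m\equiv -1\pmod 5$, let $f:\mathbb{Z}_5\to\mathbb{Z}_5$, $f(x)=x^m$, and let $t=\nu_5(m+1)$. 1. If $m\equiv 4\pmod{10}$, then the minimal decomposition of $\mathbb{Z}_5$ for $f$ is $$\mathbb{Z}_5=\{0,1\}\ \bigsqcup\ \Big(\bigcup_{l\ge0}\ \bigcup_{a=0}^{5^{t-1}-1}\ \bigcup_{i=1}^{2}M_{l,a,i}\Big)\ \bigsqcup\ \big((5\mathbb{Z}_5\setminus\{0\})\cup(2+5\mathbb{Z}_5)\cup(3+5\mathbb{Z}_5)\cup(4+5\mathbb{Z}_5)\big),$$ where $$M_{l,a,i}=(1+5^{l+1}i+5^{l+2}a+5^{t+l+1}\mathbb{Z}_5)\cup\big((1+5^{l+1}i+5^{l+2}a)^{-1}+5^{t+l+1}\mathbb{Z}_5\big).$$ Here $\{0,1\}$ is the set of periodic points (all of them fixed points), the $M_{l,a,i}$ are the minimal components, and $5\mathbb{Z}_5\setminus\{0\}$ and $(2+5\mathbb{Z}_5)\cup(3+5\mathbb{Z}_5)\cup(4+5\mathbb{Z}_5)$ are the attracting basins of $0$ and of $1+5\mathbb{Z}_5$, respectively. 2. If $m\equiv 9\pmod{20}$, then the minimal decomposition of $\mathbb{Z}_5$ for $f$ is $$\mathbb{Z}_5=\{0,\pm1,\pm\mathfrak{i}\}\ \bigsqcup\ \Big(\bigcup_{l\ge0}\ \bigcup_{a=0}^{5^{t-1}-1}\ \bigcup_{i=1}^{2}\ \bigcup_{j=1}^{4}M_{l,a,i,j}\Big)\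 \bigsqcup\ (5\mathbb{Z}_5\setminus\{0\}),$$ where $$M_{l,a,i,1}=(1+5^{l+1}i+5^{l+2}a+5^{t+l+1}\mathbb{Z}_5)\cup\big((1+5^{l+1}i+5^{l+2}a)^{-1}+5^{t+l+1}\mathbb{Z}_5\big),$$ $$M_{l,a,i,2}=(-1+5^{l+1}i+5^{l+2}a+5^{t+l+1}\mathbb{Z}_5)\cup\big((-1+5^{l+1}i+5^{l+2}a)^{-1}+5^{t+l+1}\mathbb{Z}_5\big),$$ $$M_{l,a,i,3}=(\mathfrak{i}+5^{l+1}i+5^{l+2}a+5^{t+l+1}\mathbb{Z}_5)\cup\big(-(\mathfrak{i}+5^{l+1}i+5^{l+2}a)^{-1}+5^{t+l+1}\mathbb{Z}_5\big),$$ $$M_{l,a,i,4}=(-\mathfrak{i}+5^{l+1}i+5^{l+2}a+5^{t+l+1}\mathbb{Z}_5)\cup\big(-(-\mathfrak{i}+5^{l+1}i+5^{l+2}a)^{-1}+5^{t+l+1}\mathbb{Z}_5\big).$$ Here $\{0,\pm1,\pm\mathfrak{i}\}$ is the set of periodic points (all of them fixed points), the $M_{l,a,i,j}$ are the minimal components, and $5\mathbb{Z}_5\setminus\{0\}$ is the attracting basin of the fixed point $0$. 3. If $m\equiv 19\pmod{20}$, then the minimal decomposition of $\mathbb{Z}_5$ for $f$ is $$\mathbb{Z}_5=\{0,\pm1,\pm\mathfrak{i}\}\ \bigsqcup\ \Big(\big(\bigcup_{l\ge0}\ \bigcup_{a=0}^{5^{t-1}-1}\ \bigcup_{i=1}^{2}\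 \bigcup_{j=1}^{2}M_{l,a,i,j}\big)\cup\big(\bigcup_{l\ge0}\ \bigcup_{a=0}^{5^{t-1}-1}\ \bigcup_{i=1}^{4}M'_{l,a,i}\big)\Big)\ \bigsqcup\ (5\mathbb{Z}_5\setminus\{0\}),$$ where $$M_{l,a,i,1}=(1+5^{l+1}i+5^{l+2}a+5^{t+l+1}\mathbb{Z}_5)\cup\big((1+5^{l+1}i+5^{l+2}a)^{-1}+5^{t+l+1}\mathbb{Z}_5\big),$$ $$M_{l,a,i,2}=(-1+5^{l+1}i+5^{l+2}a+5^{t+l+1}\mathbb{Z}_5)\cup\big((-1+5^{l+1}i+5^{l+2}a)^{-1}+5^{t+l+1}\mathbb{Z}_5\big),$$ $$M'_{l,a,i}=(\mathfrak{i}+5^{l+1}i+5^{l+2}a+5^{t+l+1}\mathbb{Z}_5)\cup\big((\mathfrak{i}+5^{l+1}i+5^{l+2}a)^{-1}+5^{t+l+1}\mathbb{Z}_5\big).$$ Here $\{0,\pm1,\pm\mathfrak{i}\}$ is the set of periodic points, where $0,\pm1$ are fixed points and $\{\mathfrak{i},-\mathfrak{i}\}$ is a periodic orbit of period $2$; the $M_{l,a,i,j}$ and $M'_{l,a,i}$ are the minimal components; and $5\mathbb{Z}_5\setminus\{0\}$ is the attracting basin of the fixed point $0$.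
   Context: $\mathbb{Z}_5$ is the ring of $5$-adic integers with its $5$-adic metric, and $\nu_5$ is the $5$-adic valuation; inverses are taken in $\mathbb{Z}_5$. $\mathfrak{i}=2+5+2\cdot5^2+\cdots\in\mathbb{Z}_5$ denotes the square root of $-1$ in $\mathbb{Z}_5$ with $\mathfrak{i}\equiv 2\pmod 5$ (so $-\mathfrak{i}\equiv3\pmod 5$); it is distinct from the integer index $i$. For a polynomial $f$ over $\mathbb{Z}_p$, a minimal decomposition of $\mathbb{Z}_p$ for $f$ is a partition $\mathbb{Z}_p=\mathcal{P}\sqcup\mathcal{M}\sqcup\mathcal{B}$ where (1) $\mathcal{P}$ is the set of all periodic points of $f$; (2) $\mathcal{M}=\bigsqcup_i\mathcal{M}_i$ is a disjoint union of at most countably many clopen $f$-invariant sets, each a finite union of balls, such that each subsystem $f:\mathcal{M}_i\to\mathcal{M}_i$ is minimal (every forward orbit in $\mathcal{M}_i$ is dense in $\mathcal{M}_i$); the $\mathcal{M}_i$ are called minimal components; (3) each point of $\mathcal{B}$ lies in the attracting basin of a periodic orbit or of a minimal component. A point $x$ lies in the attracting basin of a closed invariant set $A$ if the distance from $f^n(x)$ to $A$ tends to $0$ as $n\to\infty$; in describing $\mathcal{B}$, the attracting set itself is not listed as part of its basin. *)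

theory Defs
  imports "HOL-Analysis.Analysis" "HOL-Number_Theory.Cong"
begin

section \<open>The 5-adic integers\<close>

text \<open>
  \<open>\<int>\<^sub>5\<close> is the inverse limit of the rings \<open>\<int>/5\<^sup>n\<int>\<close>: an element is a sequence of canonical
  representatives, the \<open>n\<close>-th one lying in \<open>{0..<5\<^sup>n}\<close>. The range condition
  follows from the compatibility condition.
\<close>

typedef padic5 = "{x :: nat \<Rightarrow> int. \<forall>n. x (Suc n) mod 5 ^ n = x n}"
  morphisms residue Abs_padic5
  by (rule exI [of _ "\<lambda>_. 0"]) simp

setup_lifting type_definition_padic5

lemma mod_mod_pow5: "a mod 5 ^ Suc n mod 5 ^ n = a mod (5 ^ n :: int)"
  by (rule mod_mod_cancel) (simp add: le_imp_power_dvd)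

lemma residue_Suc: "residue x (Suc n) mod 5 ^ n = residue x n"
  using residue [of x] by simp

lemma residue_mod [simp]: "residue x n mod 5 ^ n = residue x n"
  by (metis residue_Suc mod_mod_trivial)

lemma residue_add_mod: "residue x (n + k) mod 5 ^ n = residue x n"
proof (induction k)
  case (Suc k)
  have "residue x (n + Suc k) mod 5 ^ n = residue x (Suc (n + k)) mod 5 ^ (n + k) mod 5 ^ n"
    by (simp add: mod_mod_cancel le_imp_power_dvd)
  then show ?case
    by (simp only: residue_Suc Suc.IH)
qed simp

lemma padic5_eqI: "(\<And>n. residue x n = residue y n) \<Longrightarrow> x = y"
  by (metis residue_inject ext)

instantiation padic5 :: comm_ring_1
begin

lift_definition zero_padic5 :: padic5 is "\<lambda>_. 0" by simp

lift_definition one_padic5 :: padic5 is "\<lambda>n. 1 mod 5 ^ n"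
  by (simp only: mod_mod_pow5 simp_thms)

lift_definition plus_padic5 :: "padic5 \<Rightarrow> padic5 \<Rightarrow> padic5"
  is "\<lambda>x y n. (x n + y n) mod 5 ^ n"
  by (metis mod_mod_pow5 mod_add_eq)

lift_definition minus_padic5 :: "padic5 \<Rightarrow> padic5 \<Rightarrow> padic5"
  is "\<lambda>x y n. (x n - y n) mod 5 ^ n"
  by (metis mod_mod_pow5 mod_diff_eq)

lift_definition uminus_padic5 :: "padic5 \<Rightarrow> padic5"
  is "\<lambda>x n. (- x n) mod 5 ^ n"
  by (metis mod_mod_pow5 mod_minus_eq)

lift_definition times_padic5 :: "padic5 \<Rightarrow> padic5 \<Rightarrow> padic5"
  is "\<lambda>x y n. (x n * y n) mod 5 ^ n"
  by (metis mod_mod_pow5 mod_mult_eq)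

instance
proof
  fix a b c :: padic5
  show "a * b * c = a * (b * c)"
    by (rule padic5_eqI) (simp add: times_padic5.rep_eq mod_simps mult.assoc)
  show "a * b = b * a"
    by (rule padic5_eqI) (simp add: times_padic5.rep_eq mult.commute)
  show "1 * a = a"
    by (rule padic5_eqI) (simp add: times_padic5.rep_eq one_padic5.rep_eq mod_simps)
  show "a + b + c = a + (b + c)"
    by (rule padic5_eqI) (simp add: plus_padic5.rep_eq mod_simps add.assoc)
  show "a + b = b + a"
    by (rule padic5_eqI) (simp add: plus_padic5.rep_eq add.commute)
  show "0 + a = a"
    by (rule padic5_eqI) (simp add: plus_padic5.rep_eq zero_padic5.rep_eq)
  show "- a + a = 0"
    by (rule padic5_eqI)
      (simp add: plus_padic5.rep_eq zero_padic5.rep_eq uminus_padic5.rep_eq mod_simps)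
  show "a - b = a + - b"
    by (rule padic5_eqI)
      (simp add: plus_padic5.rep_eq minus_padic5.rep_eq uminus_padic5.rep_eq mod_simps)
  show "(a + b) * c = a * c + b * c"
    by (rule padic5_eqI)
      (simp add: plus_padic5.rep_eq times_padic5.rep_eq mod_simps distrib_right)
  have "residue 0 1 \<noteq> residue 1 1"
    by (simp add: zero_padic5.rep_eq one_padic5.rep_eq)
  then show "(0::padic5) \<noteq> 1" by metis
qed

end

lemma residue_of_nat: "residue (of_nat k) n = int k mod 5 ^ n"
  by (induction k)
    (simp_all add: zero_padic5.rep_eq plus_padic5.rep_eq one_padic5.rep_eq mod_simps)

lemma residue_numeral: "residue (numeral k) n = numeral k mod 5 ^ n"
  by (metis residue_of_nat of_nat_numeral)

lemma residue_power: "residue (x ^ k) n = residue x n ^ k mod 5 ^ n"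
  by (induction k) (simp_all add: one_padic5.rep_eq times_padic5.rep_eq mod_simps)

lemma pow5_dvd_iff: "5 ^ n dvd x \<longleftrightarrow> residue x n = 0"
proof
  assume "5 ^ n dvd x"
  then obtain z where "x = 5 ^ n * z" ..
  then show "residue x n = 0"
    by (simp add: times_padic5.rep_eq residue_power residue_numeral mod_simps)
next
  assume x0: "residue x n = 0"
  define y where "y = Abs_padic5 (\<lambda>k. residue x (n + k) div 5 ^ n)"
  have "residue x (n + Suc k) div 5 ^ n mod 5 ^ k = residue x (n + k) div 5 ^ n" for k
  proof -
    have "residue x (n + k) = residue x (n + Suc k) mod (5 ^ n * 5 ^ k)"
      using residue_Suc [of x "n + k"] by (simp add: power_add)
    also have "\<dots> = 5 ^ n * (residue x (n + Suc k) div 5 ^ n mod 5 ^ k)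
                        + residue x (n + Suc k) mod 5 ^ n"
      by (rule zmod_zmult2_eq) simp
    finally show ?thesis
      by (simp only: residue_add_mod x0) simp
  qed
  then have y: "residue y k = residue x (n + k) div 5 ^ n" for k
    unfolding y_def by (subst Abs_padic5_inverse) simp_all
  have "x = 5 ^ n * y"
  proof (rule padic5_eqI)
    fix k
    have "residue (5 ^ n * y) k = 5 ^ n * (residue x (n + k) div 5 ^ n) mod 5 ^ k"
      by (simp add: times_padic5.rep_eq residue_power residue_numeral y mod_simps)
    also have "5 ^ n * (residue x (n + k) div 5 ^ n) = residue x (n + k)"
      using residue_add_mod [of x n k] x0 by (simp add: mod_eq_0_iff_dvd)
    finally show "residue x k = residue (5 ^ n * y) k"
      using residue_add_mod [of x k n] by (simp add: add.commute)
  qed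
  then show "5 ^ n dvd x" ..
qed

text \<open>The 5-adic valuation is only meaningful for nonzero arguments.\<close>

definition val5 :: "padic5 \<Rightarrow> nat" where
  "val5 x = (GREATEST n. 5 ^ n dvd x)"

lemma val5_iff:
  assumes "x \<noteq> 0"
  shows "5 ^ n dvd x \<longleftrightarrow> n \<le> val5 x"
proof -
  have down: "5 ^ i dvd x" if "5 ^ j dvd x" "i \<le> j" for i j
    using that by (meson dvd_trans le_imp_power_dvd)
  obtain N where N: "\<not> 5 ^ N dvd x"
    using assms by (metis padic5_eqI pow5_dvd_iff zero_padic5.rep_eq)
  have bound: "i \<le> N" if "5 ^ i dvd x" for i
    using down [OF that] N by (meson nat_le_linear)
  have "5 ^ val5 x dvd x"
    unfolding val5_def by (rule GreatestI_nat [of _ 0 N]) (use bound in auto)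
  moreover have "n \<le> val5 x" if "5 ^ n dvd x"
    unfolding val5_def by (rule Greatest_le_nat [of _ n N]) (use bound that in auto)
  ultimately show ?thesis using down by blast
qed

instantiation padic5 :: metric_space
begin

definition dist_padic5 :: "padic5 \<Rightarrow> padic5 \<Rightarrow> real" where
  "dist_padic5 x y = (if x = y then 0 else 1 / 5 ^ val5 (x - y))"

definition uniformity_padic5 :: "(padic5 \<times> padic5) filter" where
  "uniformity_padic5 = (INF e\<in>{0 <..}. principal {(x, y). dist x y < e})"

definition open_padic5 :: "padic5 set \<Rightarrow> bool" where
  "open_padic5 U \<longleftrightarrow> (\<forall>x\<in>U. eventually (\<lambda>(x', y). x' = x \<longrightarrow> y \<in> U) uniformity)"

lemma dist_padic5_le_iff: "dist x y \<le> 1 / 5 ^ n \<longleftrightarrow> 5 ^ n dvd (x - y)" for x y :: padic5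
proof (cases "x = y")
  case False
  then have "dist x y \<le> 1 / 5 ^ n \<longleftrightarrow> (5::real) ^ n \<le> 5 ^ val5 (x - y)"
    by (simp add: dist_padic5_def field_simps)
  also have "\<dots> \<longleftrightarrow> 5 ^ n dvd (x - y)"
    using False by (simp add: val5_iff)
  finally show ?thesis .
qed (simp add: dist_padic5_def)

instance
proof
  fix x y z :: padic5
  show "dist x y = 0 \<longleftrightarrow> x = y"
    by (simp add: dist_padic5_def)
  have nonneg: "0 \<le> dist u v" for u v :: padic5
    by (simp add: dist_padic5_def)
  have "dist x y \<le> max (dist x z) (dist y z)"
  proof (cases "x = z \<or> y = z")
    case True
    have "dist u v = dist v u" for u v :: padic5
    proof (rule antisym)
      have *: "dist u v \<le> dist v u" for u v :: padic5
      proof (cases "u = v")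
        case False
        then have "dist v u = 1 / 5 ^ val5 (v - u)" by (simp add: dist_padic5_def)
        moreover from this have "5 ^ val5 (v - u) dvd (u - v)"
          by (metis dist_padic5_le_iff order_refl dvd_minus_iff minus_diff_eq)
        ultimately show ?thesis by (simp only: dist_padic5_le_iff)
      qed simp
      show "dist u v \<le> dist v u" "dist v u \<le> dist u v" by (rule *)+
    qed
    with True show ?thesis by (metis max.cobounded1 max.cobounded2)
  next
    case False
    define k where "k = min (val5 (x - z)) (val5 (y - z))"
    have "5 ^ k dvd (x - z)" "5 ^ k dvd (y - z)"
      using False by (simp_all add: val5_iff k_def)
    then have "5 ^ k dvd (x - z) - (y - z)" by (rule dvd_diff)
    then have "dist x y \<le> 1 / 5 ^ k" by (simp add: dist_padic5_le_iff)
    also have "1 / 5 ^ k \<le> max (dist x z) (dist y z)"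
      using False by (simp add: dist_padic5_def k_def min_def)
    finally show ?thesis .
  qed
  then show "dist x y \<le> dist x z + dist y z"
    using nonneg [of x z] nonneg [of y z] by linarith
qed (simp_all add: uniformity_padic5_def open_padic5_def)

end

definition coset5 :: "padic5 \<Rightarrow> nat \<Rightarrow> padic5 set" where
  "coset5 a n = range (\<lambda>z. a + 5 ^ n * z)"

lemma mem_coset5_iff: "x \<in> coset5 a n \<longleftrightarrow> 5 ^ n dvd (x - a)"
  by (auto simp: coset5_def dvd_def image_iff algebra_simps)

lemma coset5_eq_cball: "coset5 a n = cball a (1 / 5 ^ n)"
  by (auto simp: mem_coset5_iff dist_padic5_le_iff [symmetric] dist_commute)

text \<open>The inverse of a unit of \<open>\<int>\<^sub>5\<close> (unspecified on non-units).\<close>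

definition inv5 :: "padic5 \<Rightarrow> padic5" where
  "inv5 x = (THE y. x * y = 1)"

lemma inv5_eqI: "x * y = 1 \<Longrightarrow> inv5 x = y"
  unfolding inv5_def by (rule the_equality) (metis mult.assoc mult.commute mult_1)+

lemma mult_inv5:
  assumes "\<not> 5 dvd x"
  shows "x * inv5 x = 1"
proof -
  have r1: "residue x 1 \<noteq> 0"
    using assms pow5_dvd_iff [of 1 x] by simp
  have cop: "coprime (residue x n) (5 ^ n)" for n
  proof (cases n)
    case (Suc k)
    have "residue x n mod 5 \<noteq> 0"
      using r1 residue_add_mod [of x 1 k] Suc by simp
    moreover have "prime (5::int)" by simp
    ultimately have "coprime (residue x n) 5"
      by (meson coprime_commute dvd_imp_mod_0 prime_imp_coprime)
    then show ?thesis by simp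
  qed simp
  then have "\<exists>k. [residue x n * k = 1] (mod 5 ^ n)" for n
    by (simp add: cong_solve_coprime_int)
  then obtain k where k: "[residue x n * k n = 1] (mod 5 ^ n)" for n
    by metis
  define y where "y = Abs_padic5 (\<lambda>n. k n mod 5 ^ n)"
  have "k (Suc n) mod 5 ^ Suc n mod 5 ^ n = k n mod 5 ^ n" for n
  proof -
    have "[residue x (Suc n) * k (Suc n) = 1] (mod 5 ^ n)"
      using k [of "Suc n"] by (rule cong_dvd_modulus) simp
    moreover have "[residue x (Suc n) = residue x n] (mod 5 ^ n)"
      by (simp add: cong_def residue_Suc)
    ultimately have "[residue x n * k (Suc n) = residue x n * k n] (mod 5 ^ n)"
      using k [of n] by (metis cong_scalar_right cong_sym cong_trans)
    then have "[k (Suc n) = k n] (mod 5 ^ n)"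
      using cop [of n] by (simp add: cong_mult_lcancel)
    then show ?thesis
      by (simp only: cong_def mod_mod_pow5)
  qed
  then have y: "residue y n = k n mod 5 ^ n" for n
    unfolding y_def by (subst Abs_padic5_inverse) simp_all
  have "x * y = 1"
    by (rule padic5_eqI)
      (use k in \<open>simp add: times_padic5.rep_eq one_padic5.rep_eq y mod_simps cong_def\<close>)
  then show ?thesis by (simp add: inv5_eqI)
qed

definition sqrt_m1 :: padic5 where
  "sqrt_m1 = (THE x. x\<^sup>2 = -1 \<and> 5 dvd (x - 2))"

lemma cong_power5:
  fixes a b :: int
  assumes "[a = b] (mod 5 ^ Suc n)"
  shows "[a ^ 5 = b ^ 5] (mod 5 ^ Suc (Suc n))"
proof -
  from assms obtain k where "a - b = 5 ^ Suc n * k"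
    by (auto simp: cong_iff_dvd_diff)
  then have a: "a = b + 5 ^ Suc n * k" by simp
  define q :: int where "q = 5 ^ n * k"
  have "a ^ 5 - b ^ 5 = 25 * q * (b ^ 4 + 10 * b ^ 3 * q + 50 * b ^ 2 * q ^ 2
          + 125 * b * q ^ 3 + 125 * q ^ 4)"
    unfolding a q_def by (simp add: power_numeral_reduce algebra_simps)
  then have "a ^ 5 - b ^ 5 = 5 ^ Suc (Suc n) * (k * (b ^ 4 + 10 * b ^ 3 * q + 50 * b ^ 2 * q ^ 2
          + 125 * b * q ^ 3 + 125 * q ^ 4))"
    by (simp add: q_def)
  then show ?thesis
    unfolding cong_iff_dvd_diff by (metis dvd_triv_left)
qed

lemma sqrt_m1_ex1: "\<exists>!x::padic5. x\<^sup>2 = -1 \<and> 5 dvd (x - 2)"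
proof (rule ex_ex1I)
  have coh: "[(2::int) ^ 5 ^ Suc n = 2 ^ 5 ^ n] (mod 5 ^ Suc n)" for n
  proof (induction n)
    case (Suc n)
    from cong_power5 [OF this] show ?case
      by (simp add: power_mult mult.commute flip: power_mult)
  qed (simp add: cong_def)
  have sq: "[(4::int) ^ 5 ^ n = -1] (mod 5 ^ Suc n)" for n
  proof (induction n)
    case (Suc n)
    from cong_power5 [OF this] show ?case
      by (simp add: mult.commute flip: power_mult)
  qed (simp add: cong_def)
  define x where "x = Abs_padic5 (\<lambda>n. 2 ^ 5 ^ n mod 5 ^ n)"
  have "2 ^ 5 ^ Suc n mod 5 ^ Suc n mod 5 ^ n = (2 ^ 5 ^ n mod 5 ^ n :: int)" for n
    using cong_dvd_modulus [OF coh [of n], of "5 ^ n"] by (simp only: mod_mod_pow5) (simp add: cong_def)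
  then have x: "residue x n = 2 ^ 5 ^ n mod 5 ^ n" for n
    unfolding x_def by (subst Abs_padic5_inverse) simp_all
  have "x\<^sup>2 = -1"
  proof (rule padic5_eqI)
    fix n
    have "residue (x\<^sup>2) n = (2 ^ 5 ^ n)\<^sup>2 mod 5 ^ n"
      by (simp add: residue_power x mod_simps)
    also have "(2 ^ 5 ^ n)\<^sup>2 = (4::int) ^ 5 ^ n"
      by (metis power2_eq_square power_mult_distrib mult_2 numeral_Bit0)
    also have "\<dots> mod 5 ^ n = -1 mod 5 ^ n"
      using cong_dvd_modulus [OF sq [of n], of "5 ^ n"] by (simp add: cong_def)
    finally show "residue (x\<^sup>2) n = residue (-1) n"
      by (simp add: uminus_padic5.rep_eq one_padic5.rep_eq mod_simps)
  qed
  moreover have "5 dvd (x - 2)"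
    using pow5_dvd_iff [of 1 "x - 2"]
    by (simp add: minus_padic5.rep_eq residue_numeral x)
  ultimately show "\<exists>x::padic5. x\<^sup>2 = -1 \<and> 5 dvd (x - 2)" by blast
next
  fix x y :: padic5
  assume x: "x\<^sup>2 = -1 \<and> 5 dvd (x - 2)" and y: "y\<^sup>2 = -1 \<and> 5 dvd (y - 2)"
  have "\<not> 5 dvd (x + y)"
  proof
    assume "5 dvd (x + y)"
    then have "5 dvd (x + y) - ((x - 2) + (y - 2))"
      using x y dvd_add dvd_diff by blast
    then have "5 ^ 1 dvd (4::padic5)" by simp
    then show False
      by (simp only: pow5_dvd_iff residue_numeral)
        simp
  qed
  then have inv: "(x + y) * inv5 (x + y) = 1" by (rule mult_inv5)
  have "(x - y) * (x + y) = x\<^sup>2 - y\<^sup>2"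
    by (simp add: power2_eq_square algebra_simps)
  then have "(x - y) * (x + y) = 0" using x y by simp
  then have "x - y = 0"
    using inv by (metis mult.assoc mult.right_neutral mult_zero_left)
  then show "x = y" by simp
qed


section \<open>Minimal decompositions\<close>

definition periodic_points :: "('a \<Rightarrow> 'a) \<Rightarrow> 'a set" where
  "periodic_points f = {x. \<exists>n>0. (f ^^ n) x = x}"

definition periodic_orbit :: "('a \<Rightarrow> 'a) \<Rightarrow> nat \<Rightarrow> 'a set \<Rightarrow> bool" where
  "periodic_orbit f n A \<longleftrightarrow>
     n > 0 \<and> (\<exists>x. (f ^^ n) x = x \<and> (\<forall>k. 0 < k \<and> k < n \<longrightarrow> (f ^^ k) x \<noteq> x)
                  \<and> A = (\<lambda>k. (f ^^ k) x) ` {..<n})"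

definition minimal_on :: "('a::metric_space \<Rightarrow> 'a) \<Rightarrow> 'a set \<Rightarrow> bool" where
  "minimal_on f S \<longleftrightarrow>
     S \<noteq> {} \<and> f ` S \<subseteq> S \<and> (\<forall>x\<in>S. S \<subseteq> closure (range (\<lambda>n. (f ^^ n) x)))"

definition finite_union_of_balls :: "'a::metric_space set \<Rightarrow> bool" where
  "finite_union_of_balls S \<longleftrightarrow>
     (\<exists>F. finite F \<and> (\<forall>(x, r)\<in>F. r > 0) \<and> S = (\<Union>(x, r)\<in>F. ball x r))"

text \<open>
  The basin contains \<open>A\<close> itself whenever \<open>A\<close> is invariant; \<open>A\<close> is to be removed explicitly
  where a basin is listed without its attractor. It is only used for nonempty \<open>A\<close>
  (\<^const>\<open>infdist\<close> to the empty set is \<open>0\<close>).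
\<close>

definition attracting_basin :: "('a::metric_space \<Rightarrow> 'a) \<Rightarrow> 'a set \<Rightarrow> 'a set" where
  "attracting_basin f A = {x. (\<lambda>n. infdist ((f ^^ n) x) A) \<longlonglongrightarrow> 0}"

text \<open>
  \<open>minimal_decomposition f P I M B\<close>: the whole space is the disjoint union of \<open>P\<close>,
  \<open>\<Union>i\<in>I. M i\<close> and \<open>B\<close>, with \<open>(M i)\<^sub>i\<^sub>\<in>\<^sub>I\<close> the family of minimal components; distinct
  indices in \<open>I\<close> give disjoint (hence distinct) components.
\<close>

definition minimal_decomposition ::
  "('a::metric_space \<Rightarrow> 'a) \<Rightarrow> 'a set \<Rightarrow> 'i set \<Rightarrow> ('i \<Rightarrow> 'a set) \<Rightarrow> 'a set \<Rightarrow> bool" where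
  "minimal_decomposition f P I M B \<longleftrightarrow>
     P \<union> (\<Union>i\<in>I. M i) \<union> B = UNIV \<and>
     P \<inter> (\<Union>i\<in>I. M i) = {} \<and> P \<inter> B = {} \<and> (\<Union>i\<in>I. M i) \<inter> B = {} \<and>
     P = periodic_points f \<and>
     countable I \<and> disjoint_family_on M I \<and>
     (\<forall>i\<in>I. open (M i) \<and> closed (M i) \<and> f ` M i \<subseteq> M i \<and>
            finite_union_of_balls (M i) \<and> minimal_on f (M i)) \<and>
     (\<forall>x\<in>B. (\<exists>n A. periodic_orbit f n A \<and> x \<in> attracting_basin f A) \<or>
            (\<exists>i\<in>I. x \<in> attracting_basin f (M i)))"


section \<open>The minimal components of the power maps\<close>

definition center :: "padic5 \<Rightarrow> nat \<Rightarrow> nat \<Rightarrow> nat \<Rightarrow> padic5" where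
  "center c l a i = c + 5 ^ (l + 1) * of_nat i + 5 ^ (l + 2) * of_nat a"

definition comp_inv :: "padic5 \<Rightarrow> nat \<Rightarrow> nat \<Rightarrow> nat \<Rightarrow> nat \<Rightarrow> padic5 set" where
  "comp_inv c t l a i =
     coset5 (center c l a i) (t + l + 1) \<union> coset5 (inv5 (center c l a i)) (t + l + 1)"

definition comp_neg_inv :: "padic5 \<Rightarrow> nat \<Rightarrow> nat \<Rightarrow> nat \<Rightarrow> nat \<Rightarrow> padic5 set" where
  "comp_neg_inv c t l a i =
     coset5 (center c l a i) (t + l + 1) \<union> coset5 (- inv5 (center c l a i)) (t + l + 1)"

end

theory Submission
  imports Defs
begin

text \<open>
  Let \<open>c\<close> be a fourth root of unity, \<open>c \<noteq> 0\<close>, and \<open>\<epsilon> = c ^ (m + 1)\<close>, a sign. If \<open>x \<equiv> c\<close> modulo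
  \<open>5 ^ (l + 1)\<close>, then \<open>x ^ (m + 1) \<equiv> \<epsilon>\<close> modulo \<open>5 ^ (t + l + 1)\<close>, because \<open>5 ^ t\<close> divides \<open>m + 1\<close>; so
  modulo \<open>5 ^ (t + l + 1)\<close> the power map is the involution \<open>x \<mapsto> \<epsilon> / x\<close>, which exchanges the two
  balls of a component. Moreover \<open>m\<^sup>2 = 1 + 5 ^ t v\<close> with \<open>v\<close> prime to \<open>5\<close>, so
  \<open>(m\<^sup>2) ^ 5 ^ k = 1 + 5 ^ (t + k) v'\<close> and, for \<open>y = 1 + 5 ^ (l + 1) u\<close> with a unit \<open>u\<close>,
  the \<open>5 ^ k\<close>-th iterate of \<open>y \<mapsto> y ^ m\<^sup>2\<close> changes \<open>y\<close> first in the digit at position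
  \<open>t + l + 1 + k\<close>. Hence every orbit of the squared map is dense in the ball of radius
  \<open>5 ^ -(t + l + 1)\<close> containing it.
  The involution negates the leading digit of \<open>x - c\<close> if \<open>c\<^sup>2 = \<epsilon>\<close>, so that two leading digits
  suffice to index the components, and it exchanges the neighbourhoods of \<open>c\<close> and \<open>-c\<close> if
  \<open>c\<^sup>2 = -\<epsilon>\<close>, where all four are needed.
\<close>

section \<open>Divisibility by powers of 5\<close>

lemma pow5_dvd_diff_iff: "5 ^ n dvd x - y \<longleftrightarrow> residue x n = residue y n"
  unfolding pow5_dvd_iff minus_padic5.rep_eq
  by (metis mod_eq_dvd_iff dvd_eq_mod_eq_0 residue_mod)

lemma five_dvd_iff: "5 dvd x \<longleftrightarrow> residue x 1 = 0"
  using pow5_dvd_iff [of 1 x] by simp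

text \<open>Passing to the residue modulo \<open>5\<close> reduces this to the primality of the
  integer \<open>5\<close>.\<close>

lemma five_dvd_mult_iff: "5 dvd x * y \<longleftrightarrow> 5 dvd x \<or> 5 dvd (y :: padic5)"
proof -
  have "prime (5::int)" by simp
  then have "5 dvd residue x 1 * residue y 1 \<longleftrightarrow> 5 dvd residue x 1 \<or> 5 dvd residue y 1"
    by (rule prime_dvd_mult_iff)
  moreover have "5 dvd residue z 1 \<longleftrightarrow> residue z 1 = 0" for z
    using residue_mod [of z 1] by (simp add: dvd_eq_mod_eq_0)
  ultimately show ?thesis
    by (simp add: five_dvd_iff times_padic5.rep_eq dvd_eq_mod_eq_0)
qed

lemma five_dvd_power_iff: "5 dvd x ^ n \<longleftrightarrow> 5 dvd (x :: padic5) \<and> n > 0"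
proof (induction n)
  case 0
  then show ?case by (simp add: five_dvd_iff one_padic5.rep_eq)
qed (auto simp: five_dvd_mult_iff)

lemma five_dvd_of_nat_iff: "5 dvd (of_nat k :: padic5) \<longleftrightarrow> 5 dvd k"
  unfolding five_dvd_iff residue_of_nat by (simp flip: zmod_int add: dvd_eq_mod_eq_0) presburger

lemma five_dvd_add_five_mult_iff: "5 dvd x + 5 * y \<longleftrightarrow> 5 dvd (x :: padic5)"
  by (simp add: dvd_add_left_iff)

text \<open>Multiplication by \<open>5 ^ n\<close> shifts the base-\<open>5\<close> digits by
  \<open>n\<close> places, so the factor can be cancelled on residues.\<close>

lemma pow5_dvd_cancel: "5 ^ (n + k) dvd 5 ^ n * x \<longleftrightarrow> 5 ^ k dvd (x :: padic5)"
proof -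
  have "residue (5 ^ n * x) (n + k) = 5 ^ n * residue x (n + k) mod 5 ^ (n + k)"
    by (simp add: times_padic5.rep_eq residue_power residue_numeral mod_simps)
  also have "\<dots> = 5 ^ n * residue x k"
    by (metis mult_mod_right power_add residue_add_mod add.commute)
  finally show ?thesis by (simp add: pow5_dvd_iff)
qed

text \<open>An element prime to \<open>5\<close> is invertible; multiplying by its inverse undoes
  the factor.\<close>

lemma pow5_dvd_unit_mult_iff:
  assumes "\<not> 5 dvd u"
  shows "5 ^ n dvd u * x \<longleftrightarrow> 5 ^ n dvd (x :: padic5)"
proof
  assume "5 ^ n dvd u * x"
  then have "5 ^ n dvd inv5 u * (u * x)" by (rule dvd_mult)
  also have "inv5 u * (u * x) = x"
    by (metis mult_inv5 [OF assms] mult.assoc mult.commute mult_1)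
  finally show "5 ^ n dvd x" .
qed simp

lemma residue_nonneg: "0 \<le> residue x n"
  by (metis residue_mod pos_mod_sign zero_less_numeral zero_less_power)

lemma residue_less: "residue x n < 5 ^ n"
  by (metis residue_mod pos_mod_bound zero_less_numeral zero_less_power)

lemma pow5_dvd_diff_residue: "5 ^ n dvd x - of_nat (nat (residue x n))"
  using residue_of_nat [of "nat (residue x n)" n] residue_nonneg [of x n]
  by (simp only: pow5_dvd_diff_iff int_nat_eq residue_mod if_True)

text \<open>The residue of a unit \<open>u\<close> generates the additive group of the residue
  field, with \<open>j\<close> the residue of \<open>d / u\<close>. This selects the number of
  iterations that corrects one digit.\<close>

lemma exists_nat_mult_cong:
  assumes "\<not> 5 dvd u"
  shows "\<exists>j. 5 dvd of_nat j * u - (d :: padic5)"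
proof -
  define j where "j = nat (residue (inv5 u * d) 1)"
  have "5 dvd inv5 u * d - of_nat j"
    using pow5_dvd_diff_residue [of 1 "inv5 u * d"] by (simp add: j_def)
  then have "5 dvd u * (inv5 u * d - of_nat j)" by (rule dvd_mult)
  also have "u * (inv5 u * d - of_nat j) = d - of_nat j * u"
    by (metis mult_inv5 [OF assms] mult.assoc mult.commute mult_1 right_diff_distrib)
  finally show ?thesis by (metis dvd_minus_iff minus_diff_eq)
qed

lemma mem_coset5_1_iff: "x \<in> coset5 c 1 \<longleftrightarrow> residue x 1 = residue c 1"
  by (simp only: mem_coset5_iff pow5_dvd_diff_iff)

section \<open>Balls of the 5-adic metric: infinitude, openness and closures\<close>

lemma inj_of_nat_padic5: "inj (of_nat :: nat \<Rightarrow> padic5)"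
proof (rule injI)
  fix i j :: nat
  assume "of_nat i = (of_nat j :: padic5)"
  then have eq: "int i mod 5 ^ (i + j) = int j mod 5 ^ (i + j)"
    by (metis residue_of_nat)
  \<comment> \<open>The modulus \<open>5 ^ (i + j)\<close> exceeds both numbers, so each of them is
    its own residue.\<close>
  have "i + j < 5 ^ (i + j)" by (rule power_gt_expt) simp
  then have "int (i + j) < 5 ^ (i + j)"
    by (metis of_nat_less_iff of_nat_numeral of_nat_power)
  then have "int i < 5 ^ (i + j)" "int j < 5 ^ (i + j)" by linarith+
  then show "i = j" using eq by (simp add: mod_pos_pos_trivial)
qed

text \<open>Infinitude of the balls is what later keeps periodic points out of the minimal
  components.\<close>

lemma infinite_coset5: "infinite (coset5 a n)"
proof
  assume "finite (coset5 a n)"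
  moreover have "range (\<lambda>k. a + 5 ^ n * of_nat k) \<subseteq> coset5 a n"
    by (auto simp: coset5_def)
  ultimately have "finite (range (\<lambda>k::nat. a + 5 ^ n * of_nat k))"
    by (rule rev_finite_subset)
  moreover have "inj (\<lambda>k::nat. a + 5 ^ n * of_nat k)"
  proof (rule injI)
    fix i j :: nat
    assume "a + 5 ^ n * of_nat i = a + 5 ^ n * of_nat j"
    then have "(of_nat (5 ^ n * i) :: padic5) = of_nat (5 ^ n * j)" by simp
    then have "5 ^ n * i = 5 ^ n * j" by (rule injD [OF inj_of_nat_padic5])
    then show "i = j" by simp
  qed
  ultimately show False using finite_imageD by blast
qed

text \<open>Nonzero distances are powers of \<open>1 / 5\<close>, so none lies strictly between
  \<open>1 / 5 ^ n\<close> and \<open>5 / 5 ^ n\<close>. The radius \<open>2 / 5 ^ n\<close> falls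
  in this gap, and the closed ball is also an open one.\<close>

lemma coset5_eq_ball: "coset5 a n = ball a (2 / 5 ^ n)"
proof -
  have "dist a x \<le> 1 / 5 ^ n" if "dist a x < 2 / 5 ^ n" for x
  proof (cases "a = x")
    case False
    define v where "v = val5 (a - x)"
    have d: "dist a x = 1 / 5 ^ v"
      using False by (simp add: dist_padic5_def v_def)
    have "n \<le> v"
    proof (rule ccontr)
      assume "\<not> n \<le> v"
      then have "(5::real) ^ Suc v \<le> 5 ^ n" by (intro power_increasing) auto
      moreover have "(5::real) ^ n < 2 * 5 ^ v" using that d by (simp add: field_simps)
      moreover have "(0::real) < 5 ^ v" by simp
      ultimately show False unfolding power_Suc by linarith
    qed
    then show ?thesis by (simp add: d frac_le)
  qed simp
  moreover have "(1::real) / 5 ^ n < 2 / 5 ^ n" by (simp add: divide_strict_right_mono)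
  ultimately show ?thesis
    unfolding coset5_eq_cball by (auto intro: le_less_trans)
qed

lemma open_coset5: "open (coset5 a n)"
  by (simp add: coset5_eq_ball)

lemma closed_coset5: "closed (coset5 a n)"
  by (simp add: coset5_eq_cball)

lemma finite_union_of_balls_coset5_Un: "finite_union_of_balls (coset5 a n \<union> coset5 b k)"
  unfolding finite_union_of_balls_def
  by (rule exI [of _ "{(a, 2 / 5 ^ n), (b, 2 / 5 ^ k)}"]) (simp add: coset5_eq_ball)

text \<open>The balls of radius \<open>1 / 5 ^ n\<close> form a neighbourhood base, so density of an
  orbit becomes solvability of congruences.\<close>

lemma closure_padic5_iff: "x \<in> closure S \<longleftrightarrow> (\<forall>n. \<exists>y\<in>S. 5 ^ n dvd y - (x :: padic5))"
proof
  assume "x \<in> closure S"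
  then show "\<forall>n. \<exists>y\<in>S. 5 ^ n dvd y - x"
    unfolding closure_approachable dist_padic5_le_iff [symmetric]
    by (meson less_imp_le zero_less_divide_1_iff zero_less_numeral zero_less_power)
next
  assume *: "\<forall>n. \<exists>y\<in>S. 5 ^ n dvd y - x"
  show "x \<in> closure S"
    unfolding closure_approachable
  proof (intro allI impI)
    fix e :: real
    assume "e > 0"
    then obtain n where "(1 / 5) ^ n < e" using real_arch_pow_inv [of e "1/5"] by auto
    then have n: "1 / 5 ^ n < e" by (simp add: power_one_over)
    obtain y where "y \<in> S" "5 ^ n dvd y - x" using * by blast
    then have "dist y x < e" using n by (simp flip: dist_padic5_le_iff)
    with \<open>y \<in> S\<close> show "\<exists>y\<in>S. dist y x < e" ..
  qed
qed

section \<open>Powers of principal units\<close>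

text \<open>First-order binomial expansion: a product of two corrections carries
  \<open>5 ^ (2 * Suc k)\<close>, which is divisible by \<open>5 ^ Suc (Suc k)\<close>. The general
  semiring serves both for natural exponents and for 5-adic bases.\<close>

lemma one_plus_pow5_power:
  fixes u :: "'a::comm_semiring_1"
  shows "\<exists>e. (1 + 5 ^ Suc k * u) ^ n = 1 + 5 ^ Suc k * (of_nat n * u + 5 * e)"
proof (induction n)
  case 0
  show ?case by (rule exI [of _ 0]) simp
next
  case (Suc n)
  then obtain e where e: "(1 + 5 ^ Suc k * u) ^ n = 1 + 5 ^ Suc k * (of_nat n * u + 5 * e)" ..
  have "(1 + 5 ^ Suc k * u) ^ Suc n
      = 1 + 5 ^ Suc k * (of_nat (Suc n) * u + 5 * (e + 5 ^ k * u * (of_nat n * u + 5 * e)))"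
    unfolding power_Suc [of "1 + 5 ^ Suc k * u"] e by (simp add: algebra_simps)
  then show ?case ..
qed

lemma one_plus_power5:
  fixes x :: "'a::comm_semiring_1"
  shows "(1 + x) ^ 5 = 1 + 5 * x + 10 * x ^ 2 + 10 * x ^ 3 + 5 * x ^ 4 + x ^ 5"
  unfolding power_numeral_reduce
  by (simp only: numeral_Bit0 numeral_Bit1 numeral_One distrib_left distrib_right
      mult_1_left mult_1_right power_one_right ac_simps Num.pred_numeral_simps BitM.simps
      power_numeral_even power_numeral_odd Let_def power_add)

text \<open>Each fifth power moves the leading correction up by exactly one place and keeps its
  digit.\<close>

lemma one_plus_pow5_power_pow5:
  fixes u :: "'a::comm_semiring_1"
  shows "\<exists>e. (1 + 5 ^ Suc k * u) ^ 5 ^ j = 1 + 5 ^ (Suc k + j) * (u + 5 * e)"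
proof (induction j)
  case 0
  show ?case by (rule exI [of _ 0]) simp
next
  case (Suc j)
  then obtain e where e: "(1 + 5 ^ Suc k * u) ^ 5 ^ j = 1 + 5 ^ (Suc k + j) * (u + 5 * e)" ..
  define A :: 'a where "A = 5 ^ (k + j)"
  define z where "z = u + 5 * e"
  \<comment> \<open>With \<open>x = 5 * A * z\<close>, the linear term of the fifth power is
    \<open>25 * A * z\<close>, and every later term is divisible by \<open>125 * A\<close>.\<close>
  have *: "(1 + 5 * A * z) ^ 5 = 1 + 5 * (5 * A)
      * (z + 5 * (2 * A * z ^ 2 + 10 * A ^ 2 * z ^ 3 + 25 * A ^ 3 * z ^ 4 + 25 * A ^ 4 * z ^ 5))"
    unfolding one_plus_power5 by (simp add: algebra_simps power_mult_distrib power_numeral_reduce)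
  have "(1 + 5 ^ Suc k * u) ^ 5 ^ Suc j = ((1 + 5 ^ Suc k * u) ^ 5 ^ j) ^ 5"
    by (simp add: mult.commute flip: power_mult)
  also have "\<dots> = (1 + 5 * A * z) ^ 5"
    unfolding e A_def z_def by simp
  also have "\<dots> = 1 + 5 ^ (Suc k + Suc j) * (u + 5 * (e +
      (2 * A * z ^ 2 + 10 * A ^ 2 * z ^ 3 + 25 * A ^ 3 * z ^ 4 + 25 * A ^ 4 * z ^ 5)))"
    unfolding * by (simp add: A_def z_def algebra_simps)
  finally show ?case ..
qed

lemma one_plus_pow5_power_general:
  fixes u :: "'a::comm_semiring_1"
  assumes "k \<ge> 1"
  shows "\<exists>e. (1 + 5 ^ k * u) ^ (5 ^ j * n) = 1 + 5 ^ (k + j) * (of_nat n * u + 5 * e)"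
proof -
  obtain k' where k: "k = Suc k'" using assms by (cases k) auto
  obtain e where e: "(1 + 5 ^ k * u) ^ 5 ^ j = 1 + 5 ^ Suc (k' + j) * (u + 5 * e)"
    using one_plus_pow5_power_pow5 [of k' u j] unfolding k by auto
  obtain e' where "(1 + 5 ^ Suc (k' + j) * (u + 5 * e)) ^ n
      = 1 + 5 ^ Suc (k' + j) * (of_nat n * (u + 5 * e) + 5 * e')"
    using one_plus_pow5_power by blast
  then have "(1 + 5 ^ k * u) ^ (5 ^ j * n)
      = 1 + 5 ^ (k + j) * (of_nat n * u + 5 * (of_nat n * e + e'))"
    by (simp add: power_mult e) (simp add: k algebra_simps)
  then show ?thesis ..
qed

text \<open>
  An approximation modulo \<open>5 ^ M\<close> improves to one modulo \<open>5 ^ Suc M\<close> because raising to the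
  power \<open>q ^ (5 ^ k * j)\<close> adds \<open>j\<close> times a unit to the digit at position \<open>M = s + t + k\<close> and
  leaves the lower digits alone.
\<close>

lemma principal_unit_power_orbit_dense:
  fixes q t v s k :: nat and y u w :: padic5
  assumes q: "q = 1 + 5 ^ t * v" "t \<ge> 1" "\<not> 5 dvd v"
    and y: "y = 1 + 5 ^ s * u" "s \<ge> 1" "\<not> 5 dvd u"
    and w: "5 ^ (s + t) dvd y - w"
  shows "\<exists>n. 5 ^ (s + t + k) dvd y ^ (q ^ n) - w"
proof (induction k)
  case 0
  show ?case using w by (intro exI [of _ 0]) simp
next
  case (Suc k)
  define M where "M = s + t + k"
  from Suc obtain n where n: "5 ^ M dvd y ^ (q ^ n) - w"
    unfolding M_def by blast
  have "5 ^ M dvd w - y ^ (q ^ n)"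
    using n by (metis dvd_minus_iff minus_diff_eq)
  then obtain d where d: "w - y ^ (q ^ n) = 5 ^ M * d" ..
  obtain e where e: "y ^ (q ^ n) = 1 + 5 ^ s * (of_nat (q ^ n) * u + 5 * e)"
    using one_plus_pow5_power_general [of s u 0 "q ^ n"] y by auto
  define u' where "u' = of_nat (q ^ n) * u + 5 * e"
  have "\<not> 5 dvd q"
  proof -
    have "5 dvd 5 ^ t * v" using q(2) by (simp add: dvd_mult2)
    then show ?thesis unfolding q(1) by presburger
  qed
  then have "\<not> 5 dvd q ^ n"
    using prime_dvd_power [of "5::nat" q n] by auto
  then have u': "\<not> 5 dvd u'"
    unfolding u'_def five_dvd_add_five_mult_iff five_dvd_mult_iff five_dvd_of_nat_iff
    using y(3) by simp
  have "\<not> 5 dvd of_nat v * u'"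
    using u' q(3) by (simp add: five_dvd_mult_iff five_dvd_of_nat_iff)
  then obtain j where j: "5 dvd of_nat j * (of_nat v * u') - d"
    using exists_nat_mult_cong by blast
  obtain e1 where e1: "q ^ (5 ^ k * j) = 1 + 5 ^ (t + k) * (j * v + 5 * e1)"
    using one_plus_pow5_power_general [of t v k j] q by auto
  obtain e2 where e2: "(1 + 5 ^ s * u') ^ (5 ^ (t + k) * (j * v + 5 * e1))
      = 1 + 5 ^ (s + (t + k)) * (of_nat (j * v + 5 * e1) * u' + 5 * e2)"
    using one_plus_pow5_power_general [of s u' "t + k"] y by blast
  obtain s' where s': "s = Suc s'" using y(2) by (cases s) auto
  obtain h where h: "of_nat j * (of_nat v * u') - d = 5 * h" using j ..
  have "y ^ (q ^ (n + 5 ^ k * j)) = (y ^ (q ^ n)) ^ (q ^ (5 ^ k * j))"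
    by (simp add: power_add power_mult)
  also have "\<dots> = y ^ (q ^ n) * (1 + 5 ^ M * (of_nat (j * v + 5 * e1) * u' + 5 * e2))"
    using e2 unfolding e1 power_add power_one_right by (simp add: e u'_def M_def power_add mult_ac)
  also have "\<dots> - w = 5 ^ M * (y ^ (q ^ n) * (of_nat (j * v + 5 * e1) * u' + 5 * e2) - d)"
    using d by (simp add: algebra_simps)
  \<comment> \<open>Since \<open>s \<ge> 1\<close>, \<open>y ^ (q ^ n)\<close> is \<open>1\<close>
    modulo \<open>5\<close>. Hence the bracket reduces modulo \<open>5\<close> to
    \<open>of_nat j * (of_nat v * u') - d\<close>, which vanishes by the choice of
    \<open>j\<close>.\<close>
  also have "\<dots> = 5 ^ M * (5 * (h + of_nat e1 * u' + e2
        + 5 ^ s' * u' * (of_nat (j * v + 5 * e1) * u' + 5 * e2)))"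
  proof -
    have d': "d = of_nat j * (of_nat v * u') - 5 * h" using h by (simp add: algebra_simps)
    show ?thesis unfolding d' e u'_def [symmetric] s' by (simp add: algebra_simps)
  qed
  finally have "5 ^ Suc M dvd y ^ (q ^ (n + 5 ^ k * j)) - w"
    by (metis dvd_triv_left mult.assoc power_Suc2)
  then show ?case unfolding M_def by auto
qed

section \<open>Power maps near roots of unity\<close>

lemma funpow_power: "((\<lambda>x. x ^ m) ^^ n) x = (x :: 'a::monoid_mult) ^ (m ^ n)"
  by (induction n) (simp_all add: mult.commute flip: power_mult)

text \<open>The indices merge into the single number \<open>i + 5 * a\<close>, whose last
  base-\<open>5\<close> digit is \<open>i\<close> whenever \<open>i < 5\<close>.\<close>

lemma mem_coset5_center_iff:
  "x \<in> coset5 (center c l a i) n \<longleftrightarrow> 5 ^ n dvd x - c - 5 ^ Suc l * of_nat (i + 5 * a)"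
  by (simp add: mem_coset5_iff center_def algebra_simps)

text \<open>Because \<open>t \<ge> 1\<close>, the radius of the ball leaves the digit
  \<open>i\<close> of \<open>x - c\<close> at position \<open>l + 1\<close> untouched; everything
  beyond it is collected in \<open>z\<close>.\<close>

lemma pow5_dvd_of_mem_center:
  assumes x: "x \<in> coset5 (center c l a i) (t + l + 1)" and t: "t \<ge> 1"
  shows "\<exists>z. x = c + 5 ^ Suc l * (of_nat i + 5 * z)"
proof -
  obtain t' where t': "t = Suc t'" using t by (cases t) auto
  obtain d where "x - c - 5 ^ Suc l * of_nat (i + 5 * a) = 5 ^ (t + l + 1) * d"
    using x unfolding mem_coset5_center_iff ..
  then have "x = c + 5 ^ Suc l * (of_nat i + 5 * (of_nat a + 5 ^ t' * d))"
    by (simp add: t' algebra_simps power_add)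
  then show ?thesis ..
qed

lemma not_five_dvd_digit:
  assumes "i \<in> {1..4}"
  shows "\<not> 5 dvd (of_nat i + 5 * z :: padic5)"
  using assms by (auto simp: five_dvd_add_five_mult_iff five_dvd_of_nat_iff dest: dvd_imp_le)

text \<open>The digit \<open>i\<close> is nonzero modulo \<open>5\<close>, so \<open>x - c\<close>
  has valuation exactly \<open>l + 1\<close>. In particular \<open>x\<close> determines
  \<open>l\<close>.\<close>

lemma pow5_dvd_diff_iff_of_mem_center:
  assumes "x \<in> coset5 (center c l a i) (t + l + 1)" "t \<ge> 1" "i \<in> {1..4}"
  shows "5 ^ n dvd x - c \<longleftrightarrow> n \<le> l + 1"
proof -
  obtain z where x: "x = c + 5 ^ Suc l * (of_nat i + 5 * z)"
    using pow5_dvd_of_mem_center [OF assms(1,2)] by blast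
  show ?thesis
  proof
    assume n: "5 ^ n dvd x - c"
    show "n \<le> l + 1"
    proof (rule ccontr)
      assume "\<not> n \<le> l + 1"
      then have "(5::padic5) ^ (Suc l + 1) dvd 5 ^ n" by (intro le_imp_power_dvd) simp
      then have "(5::padic5) ^ (Suc l + 1) dvd 5 ^ Suc l * (of_nat i + 5 * z)"
        using n by (metis x add_diff_cancel_left' dvd_trans)
      then have "5 dvd (of_nat i + 5 * z)" unfolding pow5_dvd_cancel by simp
      then show False using not_five_dvd_digit [OF assms(3)] by blast
    qed
  next
    assume "n \<le> l + 1"
    then have "(5::padic5) ^ n dvd 5 ^ Suc l" by (intro le_imp_power_dvd) simp
    then show "5 ^ n dvd x - c" unfolding x by simp
  qed
qed

text \<open>The valuation of \<open>x - c\<close> is \<open>l + 1\<close>. Of the next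
  \<open>t\<close> digits the first, which is nonzero, is \<open>i\<close>, and the other
  \<open>t - 1\<close> make up \<open>a\<close>.\<close>

lemma ex_mem_center:
  assumes c: "5 dvd x - c" "x \<noteq> c" and t: "t \<ge> 1"
  shows "\<exists>l. \<exists>a \<le> 5 ^ (t - 1) - 1. \<exists>i \<in> {1..4}. x \<in> coset5 (center c l a i) (t + l + 1)"
proof -
  have nz: "x - c \<noteq> 0" using c by simp
  have "1 \<le> val5 (x - c)" using c(1) val5_iff [OF nz, of 1] by simp
  then obtain l where l: "val5 (x - c) = Suc l" by (cases "val5 (x - c)") auto
  \<comment> \<open>\<open>R\<close> represents \<open>x - c\<close> modulo
    \<open>5 ^ (t + l + 1)\<close>. It equals \<open>5 ^ Suc l * r\<close> with
    \<open>r < 5 ^ t\<close> prime to \<open>5\<close>, and division of \<open>r\<close> by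
    \<open>5\<close> yields \<open>a\<close> and \<open>i\<close>.\<close>
  define R where "R = nat (residue (x - c) (t + l + 1))"
  have R: "int R = residue (x - c) (t + l + 1)" by (simp add: R_def residue_nonneg)
  have app: "5 ^ (t + l + 1) dvd (x - c) - of_nat R"
    unfolding R_def by (rule pow5_dvd_diff_residue)
  have "residue (x - c) (Suc l) = 0" "residue (x - c) (Suc (Suc l)) \<noteq> 0"
    unfolding pow5_dvd_iff [symmetric] val5_iff [OF nz] l by simp_all
  moreover have "int R mod 5 ^ k = residue (x - c) k" if "k \<le> t + l + 1" for k
    using that residue_add_mod [of "x - c" k "t + l + 1 - k"] R by simp
  moreover have "Suc l \<le> t + l + 1" "Suc (Suc l) \<le> t + l + 1" using t by simp_all
  ultimately have "int R mod 5 ^ Suc l = 0" "int R mod 5 ^ Suc (Suc l) \<noteq> 0"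
    by metis+
  then have R0: "5 ^ Suc l dvd R" "\<not> 5 ^ Suc (Suc l) dvd R"
    by (metis (no_types, lifting) dvd_eq_mod_eq_0 int_dvd_int_iff of_nat_numeral of_nat_power)+
  then obtain r where r: "R = 5 ^ Suc l * r" by blast
  have r5: "\<not> 5 dvd r" using R0 by (auto simp: r)
  have "int R < 5 ^ (t + l + 1)" unfolding R by (rule residue_less)
  then have "R < 5 ^ (t + l + 1)" by (metis of_nat_less_iff of_nat_numeral of_nat_power)
  then have "r < 5 ^ t" by (simp add: r power_add)
  moreover have "(5::nat) ^ t = 5 ^ (t - 1) * 5" using t by (cases t) auto
  ultimately have "r div 5 < 5 ^ (t - 1)" by (simp add: less_mult_imp_div_less)
  then have "r div 5 \<le> 5 ^ (t - 1) - 1" by simp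
  moreover have "r mod 5 \<in> {1..4}" using r5 by (auto simp: dvd_eq_mod_eq_0)
  moreover have "x \<in> coset5 (center c l (r div 5) (r mod 5)) (t + l + 1)"
    using app unfolding mem_coset5_center_iff by (simp add: r)
  ultimately show ?thesis by blast
qed

text \<open>The valuation of \<open>x - c\<close> fixes \<open>l\<close>. Then
  \<open>i + 5 * a\<close> is fixed modulo \<open>5 ^ t\<close>, and the bounds on \<open>i\<close>
  and \<open>a\<close> keep it below \<open>5 ^ t\<close>.\<close>

lemma center_unique:
  assumes x: "x \<in> coset5 (center c l a i) (t + l + 1)" "x \<in> coset5 (center c l' a' i') (t + l' + 1)"
    and t: "t \<ge> 1" and i: "i \<in> {1..4}" "i' \<in> {1..4}"
    and a: "a \<le> 5 ^ (t - 1) - 1" "a' \<le> 5 ^ (t - 1) - 1"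
  shows "l = l' \<and> a = a' \<and> i = i'"
proof -
  have l: "l = l'"
    using pow5_dvd_diff_iff_of_mem_center [OF x(1) t i(1)]
      pow5_dvd_diff_iff_of_mem_center [OF x(2) t i(2)]
    by (metis add_right_cancel le_antisym order_refl)
  have "5 ^ (t + l + 1) dvd (x - c - 5 ^ Suc l * of_nat (i + 5 * a))
      - (x - c - 5 ^ Suc l * of_nat (i' + 5 * a'))"
    using x unfolding mem_coset5_center_iff l by (rule dvd_diff)
  also have "\<dots> = of_nat (5 ^ Suc l * (i' + 5 * a')) - of_nat (5 ^ Suc l * (i + 5 * a))"
    by simp
  finally have *: "int (5 ^ Suc l * (i' + 5 * a')) mod 5 ^ (t + l + 1)
      = int (5 ^ Suc l * (i + 5 * a)) mod 5 ^ (t + l + 1)"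
    unfolding pow5_dvd_diff_iff residue_of_nat .
  have small: "int (5 ^ Suc l * (j + 5 * b)) < 5 ^ (t + l + 1)"
    if "j \<in> {1..4}" "b \<le> 5 ^ (t - 1) - 1" for j b :: nat
  proof -
    have "b < 5 ^ (t - 1)" using that(2) by (metis Suc_pred' le_imp_less_Suc zero_less_numeral zero_less_power)
    then have "j + 5 * b < 5 * 5 ^ (t - 1)" using that(1) by simp
    also have "\<dots> = 5 ^ t" using t by (cases t) auto
    finally have "5 ^ Suc l * (j + 5 * b) < 5 ^ Suc l * 5 ^ t" by simp
    also have "\<dots> = 5 ^ (t + l + 1)" by (simp add: power_add)
    finally show ?thesis by (metis of_nat_less_iff of_nat_numeral of_nat_power)
  qed
  have "int (5 ^ Suc l * (i' + 5 * a')) = int (5 ^ Suc l * (i + 5 * a))"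
    using * small [OF i(1) a(1)] small [OF i(2) a(2)]
    by (simp only: mod_pos_pos_trivial of_nat_0_le_iff)
  then have "5 ^ Suc l * (i' + 5 * a') = 5 ^ Suc l * (i + 5 * a)"
    by (simp only: of_nat_eq_iff)
  then have "i' + 5 * a' = i + 5 * a"
    by simp
  moreover have "i < 5" "i' < 5" using i by auto
  ultimately have "i = i' \<and> a = a'" by presburger
  with l show ?thesis by simp
qed

section \<open>The involution exchanging the two balls of a component\<close>

text \<open>The signs \<open>1\<close> and \<open>-1\<close> for \<open>\<epsilon>\<close> give the
  second centres in \<open>comp_inv\<close> and \<open>comp_neg_inv\<close>, so both kinds of
  component are treated at once.\<close>

definition twist :: "padic5 \<Rightarrow> padic5 \<Rightarrow> padic5" where
  "twist \<epsilon> x = \<epsilon> * inv5 x"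

definition component :: "padic5 \<Rightarrow> padic5 \<Rightarrow> nat \<Rightarrow> nat \<Rightarrow> nat \<Rightarrow> nat \<Rightarrow> padic5 set" where
  "component \<epsilon> c t l a i =
     coset5 (center c l a i) (t + l + 1) \<union> coset5 (twist \<epsilon> (center c l a i)) (t + l + 1)"

lemma comp_inv_eq_component: "comp_inv c = component 1 c"
  by (intro ext) (simp add: comp_inv_def component_def twist_def)

lemma comp_neg_inv_eq_component: "comp_neg_inv c = component (-1) c"
  by (intro ext) (simp add: comp_neg_inv_def component_def twist_def)

lemma mult_twist: "\<not> 5 dvd x \<Longrightarrow> x * twist \<epsilon> x = \<epsilon>"
  by (simp add: twist_def mult.left_commute mult_inv5)

lemma twist_eqI:
  assumes "x * y = \<epsilon>" "\<not> 5 dvd x"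
  shows "twist \<epsilon> x = y"
  unfolding twist_def assms(1) [symmetric] using mult_inv5 [OF assms(2)]
  by (metis mult.commute mult.left_commute mult_1)

lemma not_five_dvd_of_dvd_one:
  assumes "x dvd (1 :: padic5)"
  shows "\<not> 5 dvd x"
proof
  assume "5 dvd x"
  then have "5 dvd (1 :: padic5)" using assms by (rule dvd_trans)
  then show False by (simp add: five_dvd_iff one_padic5.rep_eq)
qed

context
  fixes \<epsilon> :: padic5
  assumes eps: "\<epsilon> * \<epsilon> = 1"
begin

lemma not_five_dvd_twist:
  assumes "\<not> 5 dvd x"
  shows "\<not> 5 dvd twist \<epsilon> x"
proof -
  have "\<not> 5 dvd \<epsilon>" using eps by (intro not_five_dvd_of_dvd_one) (metis dvd_triv_left)
  then show ?thesis
    using mult_twist [OF assms, of \<epsilon>] by (metis dvd_mult)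
qed

lemma twist_twist: "\<not> 5 dvd x \<Longrightarrow> twist \<epsilon> (twist \<epsilon> x) = x"
  by (rule twist_eqI) (simp_all add: mult_twist not_five_dvd_twist mult.commute)

text \<open>The involution is an isometry on units: \<open>\<epsilon> * (x * y)\<close> is a unit,
  and it carries the difference of the images to \<open>- (x - y)\<close>.\<close>

lemma pow5_dvd_twist_diff_iff:
  assumes "\<not> 5 dvd x" "\<not> 5 dvd y"
  shows "5 ^ n dvd twist \<epsilon> x - twist \<epsilon> y \<longleftrightarrow> 5 ^ n dvd x - y"
proof -
  have "x * y * (twist \<epsilon> x - twist \<epsilon> y) = (x * twist \<epsilon> x) * y - (y * twist \<epsilon> y) * x"
    by (simp add: algebra_simps)
  also have "\<dots> = \<epsilon> * (y - x)"
    using assms by (simp add: mult_twist algebra_simps)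
  finally have "\<epsilon> * (x * y * (twist \<epsilon> x - twist \<epsilon> y)) = - (x - y)"
    by (metis eps minus_diff_eq mult.assoc mult_1)
  then have *: "(\<epsilon> * (x * y)) * (twist \<epsilon> x - twist \<epsilon> y) = - (x - y)"
    by (simp only: mult.assoc)
  have "\<not> 5 dvd \<epsilon>" using eps by (intro not_five_dvd_of_dvd_one) (metis dvd_triv_left)
  then have "\<not> 5 dvd \<epsilon> * (x * y)" using assms by (simp add: five_dvd_mult_iff)
  from pow5_dvd_unit_mult_iff [OF this, of n "twist \<epsilon> x - twist \<epsilon> y"] show ?thesis
    unfolding * dvd_minus_iff by blast
qed

lemma twist_mem_coset5_iff:
  assumes "\<not> 5 dvd x" "\<not> 5 dvd y"
  shows "twist \<epsilon> x \<in> coset5 y n \<longleftrightarrow> x \<in> coset5 (twist \<epsilon> y) n"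
  using pow5_dvd_twist_diff_iff [of x "twist \<epsilon> y"] assms
  by (simp add: mem_coset5_iff twist_twist not_five_dvd_twist)

end

lemma not_five_dvd_of_mem_coset5:
  assumes "x \<in> coset5 y n" "n \<ge> 1" "\<not> 5 dvd y"
  shows "\<not> 5 dvd x"
proof -
  have "5 dvd (5::padic5) ^ n" using assms(2) by (simp add: dvd_power)
  then have "5 dvd x - y" using assms(1) unfolding mem_coset5_iff by (rule dvd_trans)
  then show ?thesis using assms(3) dvd_diff [of 5 x "x - y"] by auto
qed

lemma not_five_dvd_center:
  assumes "\<not> 5 dvd c"
  shows "\<not> 5 dvd center c l a i"
proof -
  have "center c l a i = c + 5 * (5 ^ l * of_nat i + 5 ^ (l + 1) * of_nat a)"
    by (simp add: center_def algebra_simps)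
  then show ?thesis using assms by (simp only: five_dvd_add_five_mult_iff) simp
qed

text \<open>The second ball is the image of the first under the isometric involution. Both halves
  can therefore be studied near the same root \<open>c\<close>.\<close>

lemma mem_component_iff:
  assumes "\<epsilon> * \<epsilon> = 1" "\<not> 5 dvd c"
  shows "x \<in> component \<epsilon> c t l a i \<longleftrightarrow> \<not> 5 dvd x \<and>
      (x \<in> coset5 (center c l a i) (t + l + 1) \<or> twist \<epsilon> x \<in> coset5 (center c l a i) (t + l + 1))"
  unfolding component_def Un_iff
  using not_five_dvd_center [OF assms(2)] not_five_dvd_twist [OF assms(1)]
    not_five_dvd_of_mem_coset5 [of x _ "t + l + 1"] twist_mem_coset5_iff [OF assms(1)]
  by (metis le_add2)

text \<open>The absence of periodic points is included because it is what later identifies the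
  periodic points of the whole system.\<close>

definition minimal_component :: "('a::metric_space \<Rightarrow> 'a) \<Rightarrow> 'a set \<Rightarrow> bool" where
  "minimal_component f S \<longleftrightarrow> open S \<and> closed S \<and> f ` S \<subseteq> S \<and> finite_union_of_balls S \<and>
     minimal_on f S \<and> S \<inter> periodic_points f = {}"

text \<open>The orbit of a periodic point is finite, hence closed; by minimality it would contain
  all of \<open>S\<close>.\<close>

lemma minimal_on_infinite_imp_no_periodic_points:
  assumes "minimal_on f S" "infinite S"
  shows "S \<inter> periodic_points f = {}"
proof (rule ccontr)
  assume "S \<inter> periodic_points f \<noteq> {}"
  then obtain x n where x: "x \<in> S" "n > 0" "(f ^^ n) x = x"
    by (auto simp: periodic_points_def)
  have "(f ^^ k) x \<in> (\<lambda>k. (f ^^ k) x) ` {..<n}" for k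
    using funpow_mod_eq [OF x(3), of k] x(2) by (metis imageI lessThan_iff mod_less_divisor)
  then have fin: "finite (range (\<lambda>k. (f ^^ k) x))"
    by (meson finite_imageI finite_lessThan finite_subset image_subsetI)
  have "S \<subseteq> closure (range (\<lambda>k. (f ^^ k) x))"
    using assms(1) x(1) by (auto simp: minimal_on_def)
  also have "\<dots> = range (\<lambda>k. (f ^^ k) x)"
    by (intro closure_closed finite_imp_closed fin)
  finally show False using assms(2) fin finite_subset by blast
qed

section \<open>Minimality\<close>

text \<open>The condition \<open>eps_power\<close> couples the sign to the parity of
  \<open>m\<close>. It makes \<open>c\<close> fixed by the squared map and gives
  \<open>twist \<epsilon> c\<close> the same power relation as \<open>c\<close>.\<close>

locale power_map_near_root =
  fixes m t :: nat and c \<epsilon> :: padic5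
  assumes m: "m \<ge> 2" "5 dvd m + 1" and t: "t = multiplicity 5 (m + 1)"
    and c4: "c ^ 4 = 1" and eps: "\<epsilon> * \<epsilon> = 1"
    and c_power: "c ^ (m + 1) = \<epsilon>" and eps_power: "\<epsilon> ^ m = \<epsilon>"
begin

lemma t_ge_1: "t \<ge> 1"
  unfolding t using m by (intro multiplicity_geI) auto

lemma m_decomp: "\<exists>r. m + 1 = 5 ^ t * r \<and> \<not> 5 dvd r"
proof -
  obtain r where "m + 1 = 5 ^ multiplicity 5 (m + 1) * r" "\<not> 5 dvd r"
    by (rule multiplicity_decompose' [of "m + 1" 5]) (use m in auto)
  then show ?thesis using t by blast
qed

lemma unit_c: "\<not> 5 dvd c"
  using c4 by (intro not_five_dvd_of_dvd_one) (metis dvd_power zero_less_numeral)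

lemma twist_c_eq: "twist \<epsilon> c = \<epsilon> * c ^ 3"
proof (rule twist_eqI [OF _ unit_c])
  show "c * (\<epsilon> * c ^ 3) = \<epsilon>"
    using c4 by (simp add: power_numeral_reduce mult.left_commute)
qed

text \<open>This and the next fact let every statement about a root \<open>c\<^sub>0\<close> be
  applied to \<open>twist \<epsilon> c\<close> as well, that is, to the second ball of a
  component.\<close>

lemma twist_c_4: "twist \<epsilon> c ^ 4 = 1"
proof -
  have "twist \<epsilon> c ^ 4 = (\<epsilon> * \<epsilon>) ^ 2 * (c ^ 4) ^ 3"
    unfolding twist_c_eq power_mult_distrib by (simp flip: power_mult power2_eq_square)
  then show ?thesis by (simp add: eps c4)
qed

lemma twist_c_power: "twist \<epsilon> c ^ (m + 1) = \<epsilon>"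
proof -
  have "twist \<epsilon> c ^ (m + 1) = \<epsilon> ^ m * \<epsilon> * (c ^ (m + 1)) ^ 3"
    unfolding twist_c_eq power_mult_distrib
    by (simp add: mult.commute flip: power_mult power_Suc)
  also have "\<dots> = \<epsilon> * \<epsilon> * (\<epsilon> * \<epsilon>) * \<epsilon>"
    unfolding c_power eps_power by (simp add: power_numeral_reduce mult_ac)
  finally show ?thesis by (simp add: eps)
qed

lemma power_cong_twist:
  assumes c0: "c\<^sub>0 ^ 4 = 1" "c\<^sub>0 ^ (m + 1) = \<epsilon>" and x: "5 ^ Suc l dvd x - c\<^sub>0"
  shows "5 ^ (t + l + 1) dvd x ^ m - twist \<epsilon> x"
proof -
  obtain z where z: "x - c\<^sub>0 = 5 ^ Suc l * z" using x ..
  obtain r where r: "m + 1 = 5 ^ t * r" using m_decomp by blast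
  \<comment> \<open>Since \<open>c\<^sub>0 ^ 3\<close> is the inverse of \<open>c\<^sub>0\<close>,
    the bracket is the principal unit \<open>x / c\<^sub>0\<close>.\<close>
  have x_eq: "x = c\<^sub>0 * (1 + 5 ^ Suc l * (c\<^sub>0 ^ 3 * z))"
  proof -
    have "c\<^sub>0 * (1 + 5 ^ Suc l * (c\<^sub>0 ^ 3 * z)) = c\<^sub>0 + 5 ^ Suc l * (c\<^sub>0 ^ 4 * z)"
      by (simp add: algebra_simps power_numeral_reduce)
    then show ?thesis using z c0 by (simp add: algebra_simps)
  qed
  have "\<not> 5 dvd c\<^sub>0" using c0(1) by (intro not_five_dvd_of_dvd_one) (metis dvd_power zero_less_numeral)
  then have unit: "\<not> 5 dvd x"
    using not_five_dvd_of_mem_coset5 [of x c\<^sub>0 "Suc l"] x by (simp add: mem_coset5_iff)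
  obtain e where e: "(1 + 5 ^ Suc l * (c\<^sub>0 ^ 3 * z)) ^ (m + 1)
      = 1 + 5 ^ (Suc l + t) * (of_nat r * (c\<^sub>0 ^ 3 * z) + 5 * e)"
    using one_plus_pow5_power_general [of "Suc l" _ t r] unfolding r by fastforce
  have "x ^ (m + 1) = \<epsilon> * (1 + 5 ^ (Suc l + t) * (of_nat r * (c\<^sub>0 ^ 3 * z) + 5 * e))"
    by (subst x_eq) (simp only: power_mult_distrib c0 e)
  then have "x ^ (m + 1) - \<epsilon> = 5 ^ (t + l + 1) * (\<epsilon> * (of_nat r * (c\<^sub>0 ^ 3 * z) + 5 * e))"
    by (simp add: algebra_simps power_add)
  moreover have "x * (x ^ m - twist \<epsilon> x) = x ^ (m + 1) - \<epsilon>"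
    by (simp add: right_diff_distrib mult_twist [OF unit])
  ultimately have "5 ^ (t + l + 1) dvd x * (x ^ m - twist \<epsilon> x)"
    by (metis dvd_triv_left)
  then show ?thesis by (simp only: pow5_dvd_unit_mult_iff [OF unit])
qed

text \<open>Division by \<open>c\<^sub>0\<close> turns \<open>x\<close> into a principal unit, and
  the squared map fixes \<open>c\<^sub>0\<close>. The density result for powers of principal units
  then applies with exponent \<open>m ^ 2\<close>.\<close>

lemma orbit_dense_near_root:
  assumes c0: "c\<^sub>0 ^ 4 = 1" "c\<^sub>0 ^ (m + 1) = \<epsilon>"
    and x: "\<And>n. 5 ^ n dvd x - c\<^sub>0 \<longleftrightarrow> n \<le> l + 1" and w: "5 ^ (t + l + 1) dvd x - w"
  shows "\<exists>n. 5 ^ k dvd x ^ (m ^ n) - w"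
proof -
  obtain r where r: "m + 1 = 5 ^ t * r" "\<not> 5 dvd r" using m_decomp by blast
  obtain m' where m': "m = Suc m'" using m by (cases m) auto
  have q: "m ^ 2 = 1 + 5 ^ t * (r * m')"
  proof -
    have "m ^ 2 = 1 + (m + 1) * m'" by (simp add: m' power2_eq_square)
    then show ?thesis unfolding r by (simp add: mult.assoc)
  qed
  \<comment> \<open>Here \<open>m' = m - 1\<close> is \<open>3\<close> modulo \<open>5\<close>, so
    \<open>m ^ 2 - 1\<close> has valuation exactly \<open>t\<close>.\<close>
  have v: "\<not> 5 dvd r * m'"
  proof -
    have "\<not> 5 dvd m'" using m(2) m' by presburger
    then show ?thesis using r(2) by (simp add: prime_dvd_mult_iff)
  qed
  have "\<epsilon> ^ m' = 1"
  proof -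
    have "\<epsilon> * (\<epsilon> * \<epsilon> ^ m') = \<epsilon> * \<epsilon>" using eps_power by (simp add: m')
    then show ?thesis by (simp add: eps flip: mult.assoc)
  qed
  then have c0q: "c\<^sub>0 ^ (m ^ 2) = c\<^sub>0"
  proof -
    have "m ^ 2 = 1 + (m + 1) * m'" by (simp add: m' power2_eq_square)
    then have "c\<^sub>0 ^ (m ^ 2) = c\<^sub>0 * (c\<^sub>0 ^ (m + 1)) ^ m'" by (simp only: power_add power_mult power_one_right)
    then show ?thesis using c0 \<open>\<epsilon> ^ m' = 1\<close> by simp
  qed
  have c0qn: "c\<^sub>0 ^ ((m ^ 2) ^ n) = c\<^sub>0" for n
    by (induction n) (simp_all add: power_mult c0q)
  have unit_c0: "\<not> 5 dvd c\<^sub>0"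
    using c0(1) by (intro not_five_dvd_of_dvd_one) (metis dvd_power zero_less_numeral)
  have "5 ^ Suc l dvd x - c\<^sub>0" unfolding x by simp
  then obtain z where z: "x - c\<^sub>0 = 5 ^ Suc l * z" ..
  have "\<not> 5 ^ (Suc l + 1) dvd 5 ^ Suc l * z" using x [of "Suc l + 1"] unfolding z by simp
  then have uz: "\<not> 5 dvd c\<^sub>0 ^ 3 * z"
    unfolding pow5_dvd_cancel using unit_c0 by (simp add: five_dvd_mult_iff five_dvd_power_iff)
  have y: "c\<^sub>0 ^ 3 * x = 1 + 5 ^ Suc l * (c\<^sub>0 ^ 3 * z)"
  proof -
    have "c\<^sub>0 ^ 3 * x = c\<^sub>0 ^ 4 + c\<^sub>0 ^ 3 * (x - c\<^sub>0)" by (simp add: algebra_simps power_numeral_reduce)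
    then show ?thesis unfolding z c0 by (simp add: algebra_simps)
  qed
  have w': "5 ^ (Suc l + t) dvd c\<^sub>0 ^ 3 * x - c\<^sub>0 ^ 3 * w"
    using w by (simp add: add.commute dvd_mult flip: right_diff_distrib)
  obtain n where n: "5 ^ (Suc l + t + k) dvd (c\<^sub>0 ^ 3 * x) ^ ((m ^ 2) ^ n) - c\<^sub>0 ^ 3 * w"
    using principal_unit_power_orbit_dense [OF q t_ge_1 v y _ uz w'] by auto
  have "(c\<^sub>0 ^ 3) ^ ((m ^ 2) ^ n) = c\<^sub>0 ^ 3"
    using c0qn [of n] by (metis mult.commute power_mult)
  then have "(c\<^sub>0 ^ 3 * x) ^ ((m ^ 2) ^ n) - c\<^sub>0 ^ 3 * w = c\<^sub>0 ^ 3 * (x ^ (m ^ (2 * n)) - w)"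
    by (simp add: power_mult_distrib right_diff_distrib flip: power_mult)
  with n have "5 ^ (Suc l + t + k) dvd x ^ (m ^ (2 * n)) - w"
    using unit_c0 by (simp only: pow5_dvd_unit_mult_iff five_dvd_power_iff simp_thms)
  moreover have "(5::padic5) ^ k dvd 5 ^ (Suc l + t + k)" by (intro le_imp_power_dvd) simp
  ultimately show ?thesis using dvd_trans by blast
qed

text \<open>The power map exchanges the two balls, and its orbits are dense within the ball of their
  starting point; one further step handles a target in the other ball.\<close>

lemma component_minimal:
  assumes i: "i \<in> {1..4}"
  shows "minimal_component (\<lambda>x. x ^ m) (component \<epsilon> c t l a i)"
proof -
  define z where "z = center c l a i"
  define K where "K = t + l + 1"
  have S: "component \<epsilon> c t l a i = coset5 z K \<union> coset5 (twist \<epsilon> z) K"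
    by (simp add: component_def z_def K_def)
  have uz: "\<not> 5 dvd z" "\<not> 5 dvd twist \<epsilon> z"
    using not_five_dvd_center [OF unit_c] not_five_dvd_twist [OF eps] by (simp_all add: z_def)
  have unit: "\<not> 5 dvd x" if "x \<in> coset5 z K \<or> x \<in> coset5 (twist \<epsilon> z) K" for x
    using that uz not_five_dvd_of_mem_coset5 [of x _ K] by (auto simp: K_def)
  have near: "5 ^ n dvd x - c \<longleftrightarrow> n \<le> l + 1" if "x \<in> coset5 z K" for x n
    using pow5_dvd_diff_iff_of_mem_center [OF _ t_ge_1 i] that unfolding z_def K_def by blast
  \<comment> \<open>The distance to \<open>twist \<epsilon> c\<close> is transported from the first
    ball by the isometry.\<close>
  have near': "5 ^ n dvd x - twist \<epsilon> c \<longleftrightarrow> n \<le> l + 1" if "x \<in> coset5 (twist \<epsilon> z) K" for x n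
  proof -
    have "\<not> 5 dvd x" using unit that by blast
    moreover from this have "twist \<epsilon> x \<in> coset5 z K"
      using that uz by (simp add: twist_mem_coset5_iff [OF eps])
    ultimately show ?thesis
      using near pow5_dvd_twist_diff_iff [OF eps, of "twist \<epsilon> x" c n] unit_c
      by (simp add: not_five_dvd_twist [OF eps] twist_twist [OF eps])
  qed
  have near_twist: "x ^ m \<in> coset5 y K" if "5 ^ K dvd x ^ m - twist \<epsilon> x" "twist \<epsilon> x \<in> coset5 y K" for x y
    using dvd_add [OF that(1) that(2) [unfolded mem_coset5_iff]] by (simp add: mem_coset5_iff)
  have swap: "x ^ m \<in> coset5 (twist \<epsilon> z) K" if "x \<in> coset5 z K" for x
  proof (rule near_twist)
    show "5 ^ K dvd x ^ m - twist \<epsilon> x"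
      unfolding K_def by (intro power_cong_twist [OF c4 c_power]) (simp only: near [OF that])
    show "twist \<epsilon> x \<in> coset5 (twist \<epsilon> z) K"
      using that uz unit [of x] by (simp add: twist_mem_coset5_iff [OF eps] twist_twist [OF eps])
  qed
  have swap': "x ^ m \<in> coset5 z K" if "x \<in> coset5 (twist \<epsilon> z) K" for x
  proof (rule near_twist)
    show "5 ^ K dvd x ^ m - twist \<epsilon> x"
      unfolding K_def by (intro power_cong_twist [OF twist_c_4 twist_c_power])
        (simp only: near' [OF that])
    show "twist \<epsilon> x \<in> coset5 z K"
      using that uz unit [of x] by (simp add: twist_mem_coset5_iff [OF eps])
  qed
  have diff: "5 ^ K dvd x - w" if "x \<in> coset5 y K" "w \<in> coset5 y K" for x w y
    using dvd_diff [OF that [unfolded mem_coset5_iff]] by simp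
  have dense: "\<exists>n. 5 ^ k dvd x ^ (m ^ n) - w"
    if "x \<in> coset5 z K \<and> w \<in> coset5 z K \<or> x \<in> coset5 (twist \<epsilon> z) K \<and> w \<in> coset5 (twist \<epsilon> z) K" for x w k
    using that orbit_dense_near_root [OF c4 c_power near diff [unfolded K_def]]
      orbit_dense_near_root [OF twist_c_4 twist_c_power near' diff [unfolded K_def]]
    unfolding K_def by blast
  have "\<exists>n. 5 ^ k dvd x ^ (m ^ n) - w"
    if xw: "x \<in> coset5 z K \<union> coset5 (twist \<epsilon> z) K" "w \<in> coset5 z K \<union> coset5 (twist \<epsilon> z) K" for x w k
  proof (cases "x \<in> coset5 z K \<and> w \<in> coset5 z K \<or> x \<in> coset5 (twist \<epsilon> z) K \<and> w \<in> coset5 (twist \<epsilon> z) K")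
    \<comment> \<open>Here \<open>x\<close> and \<open>w\<close> lie in different balls, so
      \<open>x ^ m\<close> lies in the ball of \<open>w\<close>.\<close>
    case False
    then obtain n where "5 ^ k dvd (x ^ m) ^ (m ^ n) - w"
      using dense [of "x ^ m" w k] xw swap swap' by blast
    then have "5 ^ k dvd x ^ (m ^ Suc n) - w" by (simp add: power_mult)
    then show ?thesis ..
  qed (rule dense)
  then have "minimal_on (\<lambda>x. x ^ m) (component \<epsilon> c t l a i)"
    unfolding minimal_on_def S funpow_power
    using swap swap' infinite_coset5 [of z K] by (auto simp: closure_padic5_iff)
  moreover have "infinite (component \<epsilon> c t l a i)"
    by (simp add: S infinite_coset5)
  moreover have "open (component \<epsilon> c t l a i)" "closed (component \<epsilon> c t l a i)"
    by (simp_all add: S open_Un closed_Un open_coset5 closed_coset5)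
  moreover have "finite_union_of_balls (component \<epsilon> c t l a i)"
    unfolding S by (rule finite_union_of_balls_coset5_Un)
  ultimately show ?thesis
    unfolding minimal_component_def
    by (metis minimal_on_def minimal_on_infinite_imp_no_periodic_points)
qed

text \<open>Residues modulo \<open>5\<close> tell apart components that belong to different
  roots.\<close>

lemma residue_of_mem_component:
  assumes "x \<in> component \<epsilon> c t l a i"
  shows "residue x 1 = residue c 1 \<or> residue x 1 = residue (twist \<epsilon> c) 1"
proof -
  have *: "5 ^ 1 dvd y - c" if "y \<in> coset5 (center c l a i) (t + l + 1)" for y
    using pow5_dvd_of_mem_center [OF that t_ge_1] by auto
  from assms consider "x \<in> coset5 (center c l a i) (t + l + 1)" 
    | "\<not> 5 dvd x" "twist \<epsilon> x \<in> coset5 (center c l a i) (t + l + 1)"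
    by (auto simp: mem_component_iff [OF eps unit_c])
  then show ?thesis
  proof cases
    case 1
    from * [OF this] show ?thesis by (simp only: pow5_dvd_diff_iff simp_thms)
  next
    case 2
    have "5 ^ 1 dvd x - twist \<epsilon> c"
      using * [OF 2(2)] pow5_dvd_twist_diff_iff [OF eps, of x "twist \<epsilon> c" 1] 2(1) unit_c
      by (simp add: not_five_dvd_twist [OF eps] twist_twist [OF eps])
    then show ?thesis by (simp only: pow5_dvd_diff_iff simp_thms)
  qed
qed

end

section \<open>The partition into components\<close>

context power_map_near_root
begin

lemma power_c: "c ^ m = twist \<epsilon> c"
  using c_power unit_c by (intro twist_eqI [symmetric]) simp_all

lemma ex_mem_component:
  assumes "residue x 1 = residue c 1" "x \<noteq> c"
  shows "\<exists>l. \<exists>a \<le> 5 ^ (t - 1) - 1. \<exists>i \<in> {1..4}. x \<in> component \<epsilon> c t l a i"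
  using ex_mem_center [of x c t] assms t_ge_1 pow5_dvd_diff_iff [of 1 x c]
  unfolding component_def by auto

text \<open>For \<open>\<epsilon> = c * c\<close> the isometry fixes \<open>c\<close>, so
  \<open>x\<close> and its image are equally far from \<open>c\<close>. The identity
  \<open>x * twist \<epsilon> x = c * c\<close>, taken to first order, makes the leading digits
  opposite modulo \<open>5\<close>.\<close>

lemma digits_of_twist_sum:
  assumes "\<epsilon> = c * c" and x: "\<not> 5 dvd x" "x \<in> coset5 (center c l a i) (t + l + 1)"
    "twist \<epsilon> x \<in> coset5 (center c l' a' i') (t + l' + 1)"
    and i: "i \<in> {1..4}" "i' \<in> {1..4}"
  shows "l = l' \<and> i + i' = 5"
proof -
  have tc: "twist \<epsilon> c = c"
    using assms(1) unit_c by (intro twist_eqI) simp_all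
  have "5 ^ n dvd x - c \<longleftrightarrow> 5 ^ n dvd twist \<epsilon> x - c" for n
    using pow5_dvd_twist_diff_iff [OF eps x(1) unit_c, of n] by (simp add: tc)
  then have l: "l = l'"
    using pow5_dvd_diff_iff_of_mem_center [OF x(2) t_ge_1 i(1)]
      pow5_dvd_diff_iff_of_mem_center [OF x(3) t_ge_1 i(2)]
    by (metis add_right_cancel le_antisym order_refl)
  obtain y where y: "x = c + 5 ^ Suc l * (of_nat i + 5 * y)"
    using pow5_dvd_of_mem_center [OF x(2) t_ge_1] by blast
  obtain z where z: "twist \<epsilon> x = c + 5 ^ Suc l * (of_nat i' + 5 * z)"
    using pow5_dvd_of_mem_center [OF x(3) t_ge_1] l by blast
  have "x * twist \<epsilon> x - c * c = 0"
    using mult_twist [OF x(1), of \<epsilon>] assms(1) by simp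
  also have "x * twist \<epsilon> x - c * c = (c + 5 ^ Suc l * (of_nat i + 5 * y))
      * (c + 5 ^ Suc l * (of_nat i' + 5 * z)) - c * c"
    by (simp only: z flip: y)
  also have "\<dots> = 5 ^ Suc l * (c * of_nat (i + i')
      + 5 * (c * (y + z) + 5 ^ l * (of_nat i + 5 * y) * (of_nat i' + 5 * z)))"
    by (simp add: algebra_simps)
  finally have "5 ^ (Suc l + 1) dvd 5 ^ Suc l * (c * of_nat (i + i')
      + 5 * (c * (y + z) + 5 ^ l * (of_nat i + 5 * y) * (of_nat i' + 5 * z)))"
    by simp
  then have "5 dvd i + i'"
    unfolding pow5_dvd_cancel power_one_right five_dvd_add_five_mult_iff five_dvd_mult_iff
      five_dvd_of_nat_iff using unit_c by blast
  \<comment> \<open>Both digits lie in \<open>{1..4}\<close>, so their sum is between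
    \<open>2\<close> and \<open>8\<close>.\<close>
  then have "i + i' = 5" using i by auto
  with l show ?thesis by simp
qed

text \<open>The leading digits of \<open>x\<close> and of its image sum to \<open>5\<close>, so one
  of the two is \<open>1\<close> or \<open>2\<close>.\<close>

lemma ex_mem_component_half:
  assumes "\<epsilon> = c * c" and x: "residue x 1 = residue c 1" "x \<noteq> c"
  shows "\<exists>l. \<exists>a \<le> 5 ^ (t - 1) - 1. \<exists>i \<in> {1..2}. x \<in> component \<epsilon> c t l a i"
proof -
  have tc: "twist \<epsilon> c = c"
    using assms(1) unit_c by (intro twist_eqI) simp_all
  have xc: "5 ^ 1 dvd x - c" using x by (simp only: pow5_dvd_diff_iff)
  then have unit: "\<not> 5 dvd x"
    using not_five_dvd_of_mem_coset5 [of x c 1] unit_c by (simp add: mem_coset5_iff)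
  have "5 ^ 1 dvd twist \<epsilon> x - c"
    using pow5_dvd_twist_diff_iff [OF eps unit unit_c, of 1] xc tc by simp
  moreover have "twist \<epsilon> x \<noteq> c"
    using twist_twist [OF eps unit] x(2) tc by metis
  ultimately obtain l' a' i' where tw: "a' \<le> 5 ^ (t - 1) - 1" "i' \<in> {1..4}"
    "twist \<epsilon> x \<in> coset5 (center c l' a' i') (t + l' + 1)"
    using ex_mem_center [of "twist \<epsilon> x" c t] t_ge_1 by auto
  obtain l a i where di: "a \<le> 5 ^ (t - 1) - 1" "i \<in> {1..4}"
    "x \<in> coset5 (center c l a i) (t + l + 1)"
    using ex_mem_center [of x c t] t_ge_1 xc x(2) by auto
  have "i + i' = 5"
    using digits_of_twist_sum [OF assms(1) unit di(3) tw(3) di(2) tw(2)] by simp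
  then have "i \<in> {1..2} \<or> i' \<in> {1..2}" using di(2) tw(2) by auto
  then show ?thesis
    using di tw unit mem_component_iff [OF eps unit_c] by metis
qed

text \<open>If \<open>x\<close> were in the first ball of one component and its image in the first
  ball of the other, their digits would sum to \<open>5\<close>, but each is at most
  \<open>2\<close>. The remaining cases reduce to \<open>center_unique\<close>.\<close>

lemma component_unique_half:
  assumes "\<epsilon> = c * c"
    and x: "x \<in> component \<epsilon> c t l a i" "x \<in> component \<epsilon> c t l' a' i'"
    and i: "i \<in> {1..2}" "i' \<in> {1..2}" and a: "a \<le> 5 ^ (t - 1) - 1" "a' \<le> 5 ^ (t - 1) - 1"
  shows "l = l' \<and> a = a' \<and> i = i'"
proof -
  have i4: "i \<in> {1..4}" "i' \<in> {1..4}" using i by auto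
  have "i + i' \<noteq> 5" "i' + i \<noteq> 5" using i by auto
  then show ?thesis
    using x center_unique [OF _ _ t_ge_1 i4 a] digits_of_twist_sum [OF assms(1)] i4
    unfolding mem_component_iff [OF eps unit_c] by metis
qed

text \<open>For \<open>\<epsilon> = - (c * c)\<close> the involution sends \<open>c\<close> to
  \<open>- c\<close>, so the two balls of a component lie in different residue classes and cannot be
  confused; no digits are identified.\<close>

lemma component_unique_full:
  assumes "\<epsilon> = - (c * c)"
    and x: "x \<in> component \<epsilon> c t l a i" "x \<in> component \<epsilon> c t l' a' i'"
    and i: "i \<in> {1..4}" "i' \<in> {1..4}" and a: "a \<le> 5 ^ (t - 1) - 1" "a' \<le> 5 ^ (t - 1) - 1"
  shows "l = l' \<and> a = a' \<and> i = i'"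
proof -
  have tc: "twist \<epsilon> c = - c"
    using assms(1) unit_c by (intro twist_eqI) simp_all
  have mod5: "5 ^ 1 dvd y - c" if "y \<in> coset5 (center c l a i) (t + l + 1)" for y l a i
    using pow5_dvd_of_mem_center [OF that t_ge_1] by auto
  have "\<not> (x \<in> coset5 (center c l a i) (t + l + 1) \<and> twist \<epsilon> x \<in> coset5 (center c l' a' i') (t + l' + 1))"
    for l a i l' a' i'
  proof
    assume *: "x \<in> coset5 (center c l a i) (t + l + 1) \<and> twist \<epsilon> x \<in> coset5 (center c l' a' i') (t + l' + 1)"
    have "\<not> 5 dvd x" using x mem_component_iff [OF eps unit_c] by blast
    moreover have "5 ^ 1 dvd twist \<epsilon> x - c" using mod5 * by blast
    ultimately have "5 ^ 1 dvd x - twist \<epsilon> c"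
      using pow5_dvd_twist_diff_iff [OF eps, of x "twist \<epsilon> c" 1] unit_c
      by (simp add: not_five_dvd_twist [OF eps] twist_twist [OF eps])
    then have "5 dvd x + c" by (simp add: tc)
    moreover have "5 ^ 1 dvd x - c" using mod5 * by blast
    \<comment> \<open>The difference is \<open>2 * c\<close>, a unit.\<close>
    ultimately have "5 dvd (x + c) - (x - c)" by (metis dvd_diff power_one_right)
    then have "5 dvd of_nat 2 * c" by simp
    then show False unfolding five_dvd_mult_iff five_dvd_of_nat_iff using unit_c by simp
  qed
  then show ?thesis
    using x center_unique [OF _ _ t_ge_1 i a] unfolding mem_component_iff [OF eps unit_c] by metis
qed

end

text \<open>Since neither the components nor \<open>B\<close> contain periodic points, the covering
  forces every periodic point into \<open>P\<close>.\<close>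

lemma minimal_decompositionI:
  assumes "\<And>x. x \<in> P \<or> (\<exists>i\<in>I. x \<in> M i) \<or> x \<in> B"
    and "P \<subseteq> periodic_points f" and "B \<inter> periodic_points f = {}"
    and M: "\<And>i. i \<in> I \<Longrightarrow> minimal_component f (M i)"
    and MB: "\<And>x i. i \<in> I \<Longrightarrow> x \<in> M i \<Longrightarrow> x \<notin> B"
    and "countable I"
    and disj: "\<And>x i j. i \<in> I \<Longrightarrow> j \<in> I \<Longrightarrow> x \<in> M i \<Longrightarrow> x \<in> M j \<Longrightarrow> i = j"
    and "\<And>x. x \<in> B \<Longrightarrow> (\<exists>n A. periodic_orbit f n A \<and> x \<in> attracting_basin f A) \<or>
            (\<exists>i\<in>I. x \<in> attracting_basin f (M i))"
  shows "minimal_decomposition f P I M B"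
proof -
  have np: "x \<notin> periodic_points f" if "i \<in> I" "x \<in> M i" for i x
    using M [OF that(1)] that(2) by (auto simp: minimal_component_def)
  have "P = periodic_points f"
    using assms(1-3) np by blast
  moreover have "disjoint_family_on M I"
    unfolding disjoint_family_on_def using disj by blast
  moreover have "P \<union> (\<Union>i\<in>I. M i) \<union> B = UNIV" using assms(1) by blast
  moreover have "(\<Union>i\<in>I. M i) \<inter> B = {}" using MB by blast
  moreover have "P \<inter> (\<Union>i\<in>I. M i) = {}" "P \<inter> B = {}" using assms(2,3) np by blast+
  ultimately show ?thesis
    unfolding minimal_decomposition_def using assms(6,8) M by (simp add: minimal_component_def)
qed

section \<open>Basins\<close>

lemma funpow_mem_invariant:
  assumes "f ` A \<subseteq> A" "x \<in> A"
  shows "(f ^^ n) x \<in> A"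
  using assms by (induction n) auto

text \<open>An orbit that enters an invariant set stays there, so its distance to the set is
  eventually \<open>0\<close>.\<close>

lemma mem_attracting_basin_of_funpow_mem:
  assumes "f ` A \<subseteq> A" "(f ^^ k) x \<in> A"
  shows "x \<in> attracting_basin f A"
proof -
  have "infdist ((f ^^ n) x) A = 0" if "n \<ge> k" for n
  proof -
    have "(f ^^ n) x = (f ^^ (n - k)) ((f ^^ k) x)"
      using that by (metis comp_apply funpow_add le_add_diff_inverse2)
    then show ?thesis using funpow_mem_invariant [OF assms] by simp
  qed
  then have "eventually (\<lambda>n. infdist ((f ^^ n) x) A = 0) sequentially"
    by (auto simp: eventually_sequentially)
  then show ?thesis unfolding attracting_basin_def by (simp add: tendsto_eventually)
qed

lemma fixed_point_periodic:
  assumes "f x = x"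
  shows "x \<in> periodic_points f" "periodic_orbit f 1 {x}"
  using assms by (auto simp: periodic_points_def periodic_orbit_def intro!: exI [of _ 1] exI [of _ x])

lemma pow5_dvd_iterated_power:
  assumes "5 dvd (x :: padic5)" "m \<ge> 2"
  shows "5 ^ n dvd x ^ (m ^ n)"
proof -
  have "n < m ^ n" using assms(2) by (intro power_gt_expt) simp
  then have "(5::padic5) ^ n dvd 5 ^ (m ^ n)" by (intro le_imp_power_dvd) simp
  also have "\<dots> dvd x ^ (m ^ n)" using assms(1) by (rule dvd_power_same)
  finally show ?thesis .
qed

lemma coset5_0_eq: "coset5 0 1 = {x. 5 dvd x}"
  by (auto simp: mem_coset5_iff)

text \<open>Iterates of a multiple of \<open>5\<close> gain valuation without bound, whereas powers
  of a unit remain at distance \<open>1\<close> from \<open>0\<close>.\<close>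

lemma attracting_basin_power_map_0:
  assumes "m \<ge> 2"
  shows "attracting_basin (\<lambda>x::padic5. x ^ m) {0} = coset5 0 1"
proof -
  have "(\<lambda>n. dist (x ^ (m ^ n)) 0) \<longlonglongrightarrow> 0" if "5 dvd x" for x :: padic5
  proof (rule Lim_null_comparison)
    have "dist (x ^ (m ^ n)) 0 \<le> (1 / 5) ^ n" for n
      using pow5_dvd_iterated_power [OF that assms, of n]
      unfolding power_one_over dist_padic5_le_iff by simp
    then show "eventually (\<lambda>n. norm (dist (x ^ (m ^ n)) 0) \<le> (1 / 5) ^ n) sequentially"
      by simp
    show "(\<lambda>n. (1 / 5 :: real) ^ n) \<longlonglongrightarrow> 0" by (rule LIMSEQ_power_zero) simp
  qed
  moreover have "\<not> (\<lambda>n. dist (x ^ (m ^ n)) 0) \<longlonglongrightarrow> 0" if "\<not> 5 dvd x" for x :: padic5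
  proof
    assume "(\<lambda>n. dist (x ^ (m ^ n)) 0) \<longlonglongrightarrow> 0"
    then have "eventually (\<lambda>n. dist (x ^ (m ^ n)) 0 < 1 / 5 ^ 1) sequentially"
      by (rule order_tendstoD) simp
    then obtain n where "dist (x ^ (m ^ n)) 0 < 1 / 5 ^ 1"
      using eventually_happens' [OF sequentially_bot] by blast
    then have "dist (x ^ (m ^ n)) 0 \<le> 1 / 5 ^ 1" by (rule less_imp_le)
    then have "5 dvd x ^ (m ^ n)" unfolding dist_padic5_le_iff by simp
    then show False using that by (simp add: five_dvd_power_iff)
  qed
  ultimately have "(\<lambda>n. dist (x ^ (m ^ n)) 0) \<longlonglongrightarrow> 0 \<longleftrightarrow> 5 dvd x" for x :: padic5
    by metis
  then show ?thesis
    by (simp only: attracting_basin_def funpow_power infdist_singleton coset5_0_eq)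
qed

text \<open>Going round the period again and again would make a nonzero \<open>x\<close> divisible
  by every power of \<open>5\<close>; \<open>Suc (val5 x)\<close> rounds already contradict its
  valuation.\<close>

lemma no_periodic_points_in_0_ball:
  assumes "m \<ge> 2"
  shows "(coset5 0 1 - {0}) \<inter> periodic_points (\<lambda>x. x ^ m) = {}"
proof (rule ccontr)
  assume "(coset5 0 1 - {0}) \<inter> periodic_points (\<lambda>x. x ^ m) \<noteq> {}"
  then obtain x n where x: "5 dvd (x :: padic5)" "x \<noteq> 0" "n > 0" "x ^ (m ^ n) = x"
    unfolding periodic_points_def funpow_power coset5_0_eq by auto
  have "x ^ (m ^ (n * k)) = x" for k
    by (induction k) (use x(4) in \<open>simp_all add: power_add power_mult\<close>)
  then have "5 ^ (n * k) dvd x" for k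
    using pow5_dvd_iterated_power [OF x(1) assms] by metis
  then have "n * Suc (val5 x) \<le> val5 x" using val5_iff [OF x(2)] by blast
  then show False using x(3) by (cases n) auto
qed

lemma basin_0:
  assumes "m \<ge> 2" "x \<in> coset5 0 1"
  shows "\<exists>n A. periodic_orbit (\<lambda>x::padic5. x ^ m) n A \<and> x \<in> attracting_basin (\<lambda>x. x ^ m) A"
  using fixed_point_periodic(2) [of "\<lambda>x::padic5. x ^ m" 0] assms attracting_basin_power_map_0
  by (metis power_0_left not_numeral_le_zero)

section \<open>Residues modulo 5 and the fourth roots of unity\<close>

lemma residue_1_cases:
  obtains "residue x 1 = 0" | "residue x 1 = 1" | "residue x 1 = 2" | "residue x 1 = 3" | "residue x 1 = 4"
  using residue_nonneg [of x 1] residue_less [of x 1] by fastforce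

lemma fourth_power_residue:
  assumes "\<not> 5 dvd x"
  shows "residue (x ^ 4) 1 = 1"
  using assms unfolding five_dvd_iff residue_power
  by (cases x rule: residue_1_cases) simp_all

text \<open>Fourth powers of units are \<open>1\<close> modulo \<open>5\<close>, and
  \<open>4\<close> divides \<open>m ^ n\<close>. Two steps are required because an even
  \<open>m\<close> need not itself be divisible by \<open>4\<close>.\<close>

lemma iterated_even_power_mem:
  assumes "\<not> 5 dvd x" "even m" "n \<ge> 2"
  shows "x ^ (m ^ n) \<in> coset5 1 1"
proof -
  have "4 dvd m ^ n"
    using assms(2,3) by (metis dvd_power_same dvd_trans le_imp_power_dvd mult_2 numeral_Bit0 power2_eq_square)
  then obtain r where r: "m ^ n = 4 * r" ..
  have "residue ((x ^ 4) ^ r) 1 = 1"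
    unfolding residue_power [of "x ^ 4"] fourth_power_residue [OF assms(1)] by simp
  then show ?thesis
    unfolding mem_coset5_1_iff r power_mult by (simp add: one_padic5.rep_eq)
qed

lemma sqrt_m1_sq: "sqrt_m1\<^sup>2 = -1" and residue_sqrt_m1: "residue sqrt_m1 1 = 2"
proof -
  have *: "sqrt_m1\<^sup>2 = -1 \<and> 5 dvd (sqrt_m1 - 2)"
    unfolding sqrt_m1_def by (rule theI' [OF sqrt_m1_ex1])
  then show "sqrt_m1\<^sup>2 = -1" ..
  have "5 ^ 1 dvd sqrt_m1 - 2" using * by simp
  then show "residue sqrt_m1 1 = 2" by (simp only: pow5_dvd_diff_iff residue_numeral) simp
qed

lemma residue_minus_sqrt_m1: "residue (- sqrt_m1) 1 = 3"
  unfolding uminus_padic5.rep_eq residue_sqrt_m1 by simp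

lemma residue_1_1: "residue 1 1 = 1" and residue_minus_1_1: "residue (-1) 1 = 4"
  and residue_0_1: "residue 0 1 = 0"
  by (simp_all add: uminus_padic5.rep_eq one_padic5.rep_eq zero_padic5.rep_eq)

section \<open>The three cases\<close>

declare One_nat_def [simp del]

lemma power_map_near_root_1:
  assumes "m \<ge> 2" "5 dvd m + 1" "t = multiplicity 5 (m + 1)"
  shows "power_map_near_root m t 1 1"
  using assms by unfold_locales simp_all

lemma power_map_near_root_minus_1:
  assumes "m \<ge> 2" "5 dvd m + 1" "t = multiplicity 5 (m + 1)" "odd m"
  shows "power_map_near_root m t (-1) 1"
  using assms by unfold_locales simp_all

text \<open>As \<open>c\<close> squares to \<open>-1\<close>, \<open>c ^ (m + 1)\<close> is
  \<open>-1\<close> to the power \<open>(m + 1) div 2\<close>. This sign separates the two cases of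
  odd \<open>m\<close>.\<close>

lemma power_map_near_root_sqrt_m1:
  assumes "m \<ge> 2" "5 dvd m + 1" "t = multiplicity 5 (m + 1)" "odd m"
    and c: "c = sqrt_m1 \<or> c = - sqrt_m1"
  shows "power_map_near_root m t c (if 4 dvd m + 1 then 1 else - 1)"
proof -
  have c2: "c\<^sup>2 = -1" using c sqrt_m1_sq by auto
  then have c4: "c ^ 4 = 1" using power_mult [of c 2 2] by simp
  have "c ^ (m + 1) = (if 4 dvd m + 1 then 1 else - 1)"
  proof -
    obtain k where k: "m + 1 = 2 * k" using assms(4) by (metis dvdE even_add odd_one)
    then have "c ^ (m + 1) = (-1) ^ k" by (simp only: power_mult c2)
    moreover have "4 dvd m + 1 \<longleftrightarrow> even k" unfolding k by presburger
    ultimately show ?thesis by simp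
  qed
  then show ?thesis using assms c4 by unfold_locales simp_all
qed

text \<open>All units enter the residue class of \<open>1\<close> within two steps, so components
  occur only there; around \<open>c = 1\<close> the sign is \<open>\<epsilon> = c * c\<close> and
  two leading digits suffice.\<close>

lemma power_map_even_case:
  assumes m: "m \<ge> 2" "5 dvd m + 1" and t: "t = multiplicity 5 (m + 1)" and "even m"
  shows "minimal_decomposition (\<lambda>x::padic5. x ^ m) {0, 1}
          (UNIV \<times> {..5 ^ (t - 1) - 1} \<times> {1..2})
          (\<lambda>(l, a, i). comp_inv 1 t l a i)
          ((coset5 0 1 - {0}) \<union> coset5 2 1 \<union> coset5 3 1 \<union> coset5 4 1)" (is ?decomp)
    and "attracting_basin (\<lambda>x. x ^ m) (coset5 1 1) - coset5 1 1 =
          coset5 2 1 \<union> coset5 3 1 \<union> coset5 4 1" (is ?basin)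
proof -
  interpret one: power_map_near_root m t 1 1
    using m t by (rule power_map_near_root_1)
  let ?f = "\<lambda>x::padic5. x ^ m"
  have res: "residue 1 1 = 1" "residue (twist 1 1) 1 = 1"
    using residue_1_1 twist_eqI [OF mult_1, OF one.unit_c] by simp_all
  have B: "x \<in> coset5 2 1 \<union> coset5 3 1 \<union> coset5 4 1 \<longleftrightarrow> residue x 1 \<noteq> 0 \<and> residue x 1 \<noteq> 1" for x
    by (cases x rule: residue_1_cases) (simp_all add: mem_coset5_1_iff residue_numeral)
  have mem1: "x \<in> coset5 1 1 \<longleftrightarrow> residue x 1 = 1" for x
    by (simp add: mem_coset5_1_iff residue_1_1)
  have mem0: "x \<in> coset5 0 1 \<longleftrightarrow> residue x 1 = 0" for x
    by (simp add: mem_coset5_1_iff residue_0_1)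
  have f1: "?f ` coset5 1 1 \<subseteq> coset5 1 1"
    by (auto simp: mem1 residue_power)
  have enter: "(?f ^^ n) x \<in> coset5 1 1" if "residue x 1 \<noteq> 0" "n \<ge> 2" for x n
    using that iterated_even_power_mem [of x m n] \<open>even m\<close> by (simp add: funpow_power five_dvd_iff)
  have cover: "\<exists>l. \<exists>a\<le>5 ^ (t - 1) - 1. \<exists>i\<in>{1..2}. x \<in> comp_inv 1 t l a i"
    if "x \<in> coset5 1 1" "x \<noteq> 1" for x
    using one.ex_mem_component_half [of x] that by (simp add: mem1 residue_1_1 comp_inv_eq_component)
  have comp: "minimal_component ?f (comp_inv 1 t l a i)" if "i \<in> {1..2}" for l a i
    using one.component_minimal [of i l a] that by (simp add: comp_inv_eq_component)
  have comp1: "residue x 1 = 1" if "x \<in> comp_inv 1 t l a i" for x l a i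
    using one.residue_of_mem_component [of x l a i] that res by (simp add: comp_inv_eq_component)
  show ?decomp
  proof (rule minimal_decompositionI)
    fix x :: padic5
    show "x \<in> {0, 1} \<or> (\<exists>p\<in>UNIV \<times> {..5 ^ (t - 1) - 1} \<times> {1..2}.
              x \<in> (case p of (l, a, i) \<Rightarrow> comp_inv 1 t l a i)) \<or>
            x \<in> coset5 0 1 - {0} \<union> coset5 2 1 \<union> coset5 3 1 \<union> coset5 4 1"
      using cover [of x] B [of x] mem0 [of x] mem1 [of x] by fastforce
  next
    show "{0, 1} \<subseteq> periodic_points ?f"
      using fixed_point_periodic(1) [of ?f 0] fixed_point_periodic(1) [of ?f 1] m
      by (auto simp: zero_power)
  next
    have "x \<notin> periodic_points ?f" if x: "x \<in> coset5 2 1 \<union> coset5 3 1 \<union> coset5 4 1" for x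
    proof
      assume "x \<in> periodic_points ?f"
      then obtain n where n: "n > 0" "(?f ^^ n) x = x" by (auto simp: periodic_points_def)
      \<comment> \<open>Doubling the period guarantees at least two iterations, enough to land in
        the class of \<open>1\<close>, where \<open>x\<close> does not lie.\<close>
      have "(?f ^^ (n + n)) x = x" by (simp only: funpow_add comp_apply n)
      moreover have "(?f ^^ (n + n)) x \<in> coset5 1 1" using n(1) x B [of x] by (intro enter) auto
      ultimately show False using x B mem1 by simp
    qed
    then show "(coset5 0 1 - {0} \<union> coset5 2 1 \<union> coset5 3 1 \<union> coset5 4 1) \<inter> periodic_points ?f = {}"
      using no_periodic_points_in_0_ball [OF m(1)] by blast
  next
    fix p :: "nat \<times> nat \<times> nat"
    assume p: "p \<in> UNIV \<times> {..5 ^ (t - 1) - 1} \<times> {1..2}"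
    then show "minimal_component ?f (case p of (l, a, i) \<Rightarrow> comp_inv 1 t l a i)"
      using comp by auto
    fix x assume "x \<in> (case p of (l, a, i) \<Rightarrow> comp_inv 1 t l a i)"
    then have "residue x 1 = 1" using comp1 by (auto split: prod.splits)
    then show "x \<notin> coset5 0 1 - {0} \<union> coset5 2 1 \<union> coset5 3 1 \<union> coset5 4 1"
      using B [of x] mem0 [of x] by auto
    fix q :: "nat \<times> nat \<times> nat"
    assume "q \<in> UNIV \<times> {..5 ^ (t - 1) - 1} \<times> {1..2}" "x \<in> (case q of (l, a, i) \<Rightarrow> comp_inv 1 t l a i)"
    with p \<open>x \<in> (case p of (l, a, i) \<Rightarrow> comp_inv 1 t l a i)\<close> show "p = q"
      using one.component_unique_half [of x]
      by (cases p, cases q) (simp add: comp_inv_eq_component)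
  next
    fix x assume x: "x \<in> coset5 0 1 - {0} \<union> coset5 2 1 \<union> coset5 3 1 \<union> coset5 4 1"
    show "(\<exists>n A. periodic_orbit ?f n A \<and> x \<in> attracting_basin ?f A) \<or>
      (\<exists>p\<in>UNIV \<times> {..5 ^ (t - 1) - 1} \<times> {1..2}.
         x \<in> attracting_basin ?f (case p of (l, a, i) \<Rightarrow> comp_inv 1 t l a i))"
    proof (cases "x \<in> coset5 0 1")
      case True
      then show ?thesis using basin_0 [OF m(1)] by blast
    next
      case False
      then have in1: "(?f ^^ 2) x \<in> coset5 1 1" by (intro enter) (simp_all add: mem0)
      show ?thesis
      \<comment> \<open>The second iterate either hits the fixed point \<open>1\<close> or lies in a
        minimal component.\<close>
      proof (cases "(?f ^^ 2) x = 1")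
        case True
        then have "x \<in> attracting_basin ?f {1}"
          by (intro mem_attracting_basin_of_funpow_mem) auto
        moreover have "periodic_orbit ?f 1 {1}" by (rule fixed_point_periodic) simp
        ultimately show ?thesis by blast
      next
        case False
        then obtain l a i where p: "a \<le> 5 ^ (t - 1) - 1" "i \<in> {1..2}" "(?f ^^ 2) x \<in> comp_inv 1 t l a i"
          using cover in1 by blast
        then have "x \<in> attracting_basin ?f (comp_inv 1 t l a i)"
          using comp [of i l a] by (intro mem_attracting_basin_of_funpow_mem) (auto simp: minimal_component_def)
        then show ?thesis using p by (intro disjI2 bexI [of _ "(l, a, i)"]) auto
      qed
    qed
  qed simp
  show ?basin
  proof (rule set_eqI)
    fix x
    have "x \<in> attracting_basin ?f (coset5 1 1)" if "residue x 1 \<noteq> 0"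
      using enter [OF that] f1 by (intro mem_attracting_basin_of_funpow_mem) auto
    \<comment> \<open>Iterates of a multiple of \<open>5\<close> stay multiples of \<open>5\<close>,
      whereas a distance below \<open>1 / 5\<close> to some element of \<open>coset5 1 1\<close>
      would force residue \<open>1\<close>.\<close>
    moreover have "x \<notin> attracting_basin ?f (coset5 1 1)" if x: "residue x 1 = 0"
    proof
      assume "x \<in> attracting_basin ?f (coset5 1 1)"
      then have "(\<lambda>n. infdist (x ^ (m ^ n)) (coset5 1 1)) \<longlonglongrightarrow> 0"
        by (simp add: attracting_basin_def funpow_power)
      then have "eventually (\<lambda>n. infdist (x ^ (m ^ n)) (coset5 1 1) < 1 / 5 ^ 1) sequentially"
        by (rule order_tendstoD) simp
      then obtain n where n: "infdist (x ^ (m ^ n)) (coset5 1 1) < 1 / 5 ^ 1"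
        using eventually_happens' [OF sequentially_bot] by blast
      have "coset5 1 1 \<noteq> {}" using infinite_coset5 by (metis finite.emptyI)
      moreover have "bdd_below (dist (x ^ (m ^ n)) ` coset5 1 1)"
        by (rule bdd_belowI2 [where m = 0]) simp
      ultimately obtain a where a: "a \<in> coset5 1 1" "dist (x ^ (m ^ n)) a < 1 / 5 ^ 1"
        using n by (metis infdist_notempty cINF_less_iff)
      then have "5 ^ 1 dvd x ^ (m ^ n) - a"
        unfolding dist_padic5_le_iff [symmetric] by (intro less_imp_le)
      then have "residue (x ^ (m ^ n)) 1 = 1"
        using a(1) by (simp only: pow5_dvd_diff_iff mem1)
      then show False using x m by (simp add: residue_power zero_power)
    qed
    ultimately show "x \<in> attracting_basin ?f (coset5 1 1) - coset5 1 1 \<longleftrightarrow>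
        x \<in> coset5 2 1 \<union> coset5 3 1 \<union> coset5 4 1"
      using B [of x] mem1 [of x] by auto
  qed
qed

lemma fixed_by_power_map:
  assumes "power_map_near_root m t c \<epsilon>" "\<epsilon> = c * c"
  shows "c ^ m = c"
proof -
  interpret power_map_near_root m t c \<epsilon> by fact
  show ?thesis
    unfolding power_c using assms(2) unit_c by (intro twist_eqI) simp_all
qed

text \<open>Here \<open>\<epsilon> = c * c\<close> at all four roots: each root is fixed, and two
  leading digits index the components around it.\<close>

lemma power_map_odd_2_mod_4_case:
  assumes m: "m \<ge> 2" "5 dvd m + 1" and t: "t = multiplicity 5 (m + 1)"
    and "odd m" "\<not> 4 dvd m + 1"
  shows "minimal_decomposition (\<lambda>x::padic5. x ^ m) {0, 1, -1, sqrt_m1, - sqrt_m1}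
          (UNIV \<times> {..5 ^ (t - 1) - 1} \<times> {1..2} \<times> {1..4})
          (\<lambda>(l, a, i, j :: nat).
             if j = 1 then comp_inv 1 t l a i
             else if j = 2 then comp_inv (-1) t l a i
             else if j = 3 then comp_neg_inv sqrt_m1 t l a i
             else comp_neg_inv (- sqrt_m1) t l a i)
          (coset5 0 1 - {0})" (is "minimal_decomposition ?f _ ?I ?M _")
    and "sqrt_m1 ^ m = sqrt_m1" "(- sqrt_m1) ^ m = - sqrt_m1"
proof -
  let ?c = "\<lambda>j::nat. if j = 1 then 1 else if j = 2 then -1 else if j = 3 then sqrt_m1 else - sqrt_m1"
  let ?e = "\<lambda>j::nat. if j = 1 \<or> j = 2 then 1 else - 1 :: padic5"
  have root: "power_map_near_root m t (?c j) (?e j)" if "j \<in> {1..4}" for j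
    using power_map_near_root_1 [OF m t] power_map_near_root_minus_1 [OF m t \<open>odd m\<close>]
      power_map_near_root_sqrt_m1 [OF m t \<open>odd m\<close>] \<open>\<not> 4 dvd m + 1\<close> by auto
  have ec: "?e j = ?c j * ?c j" for j
    using sqrt_m1_sq by (auto simp: power2_eq_square)
  have M: "?M (l, a, i, j) = component (?e j) (?c j) t l a i" for l a i j
    by (simp add: comp_inv_eq_component comp_neg_inv_eq_component)
  have twist: "twist (?e j) (?c j) = ?c j" if "j \<in> {1..4}" for j
    using power_map_near_root.unit_c [OF root [OF that]] ec [of j] by (intro twist_eqI) metis+
  have res_c: "residue (?c j) 1 = (if j = 1 then 1 else if j = 2 then 4 else if j = 3 then 2 else 3)" for j
    by (simp add: residue_1_1 residue_minus_1_1 residue_sqrt_m1 residue_minus_sqrt_m1)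
  have res: "residue x 1 = residue (?c j) 1" if "x \<in> ?M (l, a, i, j)" "j \<in> {1..4}" for x l a i j
    using power_map_near_root.residue_of_mem_component [OF root [OF that(2)] that(1) [unfolded M]]
    unfolding twist [OF that(2)] by blast
  have fixed: "?f (?c j) = ?c j" if "j \<in> {1..4}" for j
    using root [OF that] ec by (rule fixed_by_power_map)
  from fixed [of 3] fixed [of 4] show "sqrt_m1 ^ m = sqrt_m1" "(- sqrt_m1) ^ m = - sqrt_m1"
    by simp_all
  show "minimal_decomposition ?f {0, 1, -1, sqrt_m1, - sqrt_m1} ?I ?M (coset5 0 1 - {0})"
  proof (rule minimal_decompositionI)
    fix x :: padic5
    have "x = ?c j \<or> (\<exists>p\<in>?I. x \<in> ?M p)" if j: "j \<in> {1..4}" "residue x 1 = residue (?c j) 1" for j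
    proof (cases "x = ?c j")
      case False
      obtain l a i where "a \<le> 5 ^ (t - 1) - 1" "i \<in> {1..2}" "x \<in> ?M (l, a, i, j)"
        using power_map_near_root.ex_mem_component_half [OF root [OF j(1)] ec j(2) False]
        unfolding M by blast
      then show ?thesis using j(1) by (intro disjI2 bexI [of _ "(l, a, i, j)"]) auto
    qed simp
    from this [of 1] this [of 2] this [of 3] this [of 4]
    show "x \<in> {0, 1, -1, sqrt_m1, - sqrt_m1} \<or> (\<exists>p\<in>?I. x \<in> ?M p) \<or> x \<in> coset5 0 1 - {0}"
      unfolding res_c mem_coset5_1_iff Diff_iff residue_0_1
      by (cases x rule: residue_1_cases) (simp_all split del: if_split, blast+)
  next
    show "{0, 1, -1, sqrt_m1, - sqrt_m1} \<subseteq> periodic_points ?f"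
      using fixed_point_periodic(1) [of ?f 0] fixed_point_periodic(1) [of ?f, OF fixed [of 1]]
        fixed_point_periodic(1) [of ?f, OF fixed [of 2]]
        fixed_point_periodic(1) [of ?f, OF fixed [of 3]]
        fixed_point_periodic(1) [of ?f, OF fixed [of 4]] m
      by (simp add: zero_power)
  next
    show "(coset5 0 1 - {0}) \<inter> periodic_points ?f = {}"
      by (rule no_periodic_points_in_0_ball [OF m(1)])
  next
    fix p :: "nat \<times> nat \<times> nat \<times> nat"
    assume p: "p \<in> ?I"
    obtain l a i j where p_eq: "p = (l, a, i, j)" by (cases p)
    have pI: "a \<le> 5 ^ (t - 1) - 1" "i \<in> {1..2}" "j \<in> {1..4}" using p p_eq by auto
    have "i \<in> {1..4}" using pI(2) by auto
    then show "minimal_component ?f (?M p)"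
      unfolding p_eq M by (rule power_map_near_root.component_minimal [OF root [OF pI(3)]])
    fix x assume x: "x \<in> ?M p"
    note res_x = res [OF x [unfolded p_eq] pI(3)]
    show "x \<notin> coset5 0 1 - {0}"
      using res_x unfolding res_c by (simp add: mem_coset5_1_iff residue_0_1 split: if_splits)
    fix q :: "nat \<times> nat \<times> nat \<times> nat"
    assume q: "q \<in> ?I" "x \<in> ?M q"
    obtain l' a' i' j' where q_eq: "q = (l', a', i', j')" by (cases q)
    have qI: "a' \<le> 5 ^ (t - 1) - 1" "i' \<in> {1..2}" "j' \<in> {1..4}" using q(1) q_eq by auto
    \<comment> \<open>The four roots have distinct residues modulo \<open>5\<close>, so
      \<open>x\<close> determines the index \<open>j\<close>.\<close>
    have "residue (?c j) 1 = residue (?c j') 1"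
      using res_x res [OF q(2) [unfolded q_eq] qI(3)] by (simp only:)
    then have jj: "j = j'"
      using pI(3) qI(3) unfolding res_c by (auto split: if_splits)
    have "x \<in> component (?e j) (?c j) t l' a' i'" using q(2) unfolding q_eq M jj .
    with x show "p = q"
      using power_map_near_root.component_unique_half [OF root [OF pI(3)] ec] pI qI
      unfolding p_eq q_eq jj M by blast
  next
    fix x assume "x \<in> coset5 0 1 - {0}"
    then show "(\<exists>n A. periodic_orbit ?f n A \<and> x \<in> attracting_basin ?f A) \<or>
      (\<exists>p\<in>?I. x \<in> attracting_basin ?f (?M p))"
      using basin_0 [OF m(1)] by blast
  qed simp
qed

text \<open>Here \<open>\<epsilon> = 1\<close> at all four roots. This is \<open>c * c\<close> at
  \<open>1\<close> and \<open>-1\<close> but \<open>- (c * c)\<close> at the square roots of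
  \<open>-1\<close>; components around \<open>sqrt_m1\<close> thus reach into the class of
  \<open>- sqrt_m1\<close> and need all four digits.\<close>

lemma power_map_odd_0_mod_4_case:
  assumes m: "m \<ge> 2" "5 dvd m + 1" and t: "t = multiplicity 5 (m + 1)"
    and "odd m" "4 dvd m + 1"
  shows "minimal_decomposition (\<lambda>x::padic5. x ^ m) {0, 1, -1, sqrt_m1, - sqrt_m1}
          ((UNIV \<times> {..5 ^ (t - 1) - 1} \<times> {1..2} \<times> {1..2}) <+>
           (UNIV \<times> {..5 ^ (t - 1) - 1} \<times> {1..4}))
          (case_sum
             (\<lambda>(l, a, i, j :: nat). if j = 1 then comp_inv 1 t l a i else comp_inv (-1) t l a i)
             (\<lambda>(l, a, i). comp_inv sqrt_m1 t l a i))
          (coset5 0 1 - {0})" (is "minimal_decomposition ?f _ (?I <+> ?J) ?M _")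
    and "periodic_orbit (\<lambda>x. x ^ m) 2 {sqrt_m1, - sqrt_m1}"
proof -
  let ?c = "\<lambda>j::nat. if j = 1 then 1 else -1 :: padic5"
  have root: "power_map_near_root m t (?c j) 1" for j
    using power_map_near_root_1 [OF m t] power_map_near_root_minus_1 [OF m t \<open>odd m\<close>] by simp
  interpret sq: power_map_near_root m t sqrt_m1 1
    using power_map_near_root_sqrt_m1 [OF m t \<open>odd m\<close>, of sqrt_m1] \<open>4 dvd m + 1\<close> by simp
  have ec: "1 = ?c j * ?c j" for j by simp
  have sq2: "1 = - (sqrt_m1 * sqrt_m1)"
    using sqrt_m1_sq by (simp add: power2_eq_square)
  have M: "?M (Inl (l, a, i, j)) = component 1 (?c j) t l a i" for l a i j
    by (simp add: comp_inv_eq_component)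
  have M': "?M (Inr (l, a, i)) = component 1 sqrt_m1 t l a i" for l a i
    by (simp add: comp_inv_eq_component)
  have twist: "twist 1 (?c j) = ?c j" for j
    using power_map_near_root.unit_c [OF root] ec [of j] by (intro twist_eqI) metis+
  have twist': "twist 1 sqrt_m1 = - sqrt_m1"
    using sq.unit_c sq2 by (intro twist_eqI) simp_all
  have res_c: "residue (?c j) 1 = (if j = 1 then 1 else 4)" for j
    by (simp add: residue_1_1 residue_minus_1_1)
  have res: "residue x 1 = (if j = 1 then 1 else 4)" if "x \<in> ?M (Inl (l, a, i, j))" for x l a i j
    using power_map_near_root.residue_of_mem_component [OF root that [unfolded M]]
    unfolding twist res_c by blast
  have res': "residue x 1 = 2 \<or> residue x 1 = 3" if "x \<in> ?M (Inr (l, a, i))" for x l a i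
    using sq.residue_of_mem_component [OF that [unfolded M']]
    unfolding twist' residue_sqrt_m1 residue_minus_sqrt_m1 .
  have fixed: "?f (?c j) = ?c j" for j
    using root ec by (rule fixed_by_power_map)
  have swap: "?f sqrt_m1 = - sqrt_m1" "?f (- sqrt_m1) = sqrt_m1"
    using sq.power_c \<open>odd m\<close> by (simp_all add: twist')
  have neq: "- sqrt_m1 \<noteq> sqrt_m1"
    using residue_sqrt_m1 residue_minus_sqrt_m1 by force
  show orbit: "periodic_orbit ?f 2 {sqrt_m1, - sqrt_m1}"
    unfolding periodic_orbit_def
  proof (intro conjI exI [of _ sqrt_m1] allI impI)
    show "{sqrt_m1, - sqrt_m1} = (\<lambda>k. (?f ^^ k) sqrt_m1) ` {..<2}"
      by (simp add: lessThan_Suc numeral_2_eq_2 swap insert_commute)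
    fix k :: nat
    assume "0 < k \<and> k < 2"
    then have "k = 1" by simp
    then show "(?f ^^ k) sqrt_m1 \<noteq> sqrt_m1" by (simp add: swap neq One_nat_def)
  qed (simp_all add: numeral_2_eq_2 swap)
  show "minimal_decomposition ?f {0, 1, -1, sqrt_m1, - sqrt_m1} (?I <+> ?J) ?M (coset5 0 1 - {0})"
  proof (rule minimal_decompositionI)
    fix x :: padic5
    have units: "x = ?c j \<or> (\<exists>p\<in>?I <+> ?J. x \<in> ?M p)" if j: "j \<in> {1..2}" "residue x 1 = residue (?c j) 1" for j
    proof (cases "x = ?c j")
      case False
      obtain l a i where "a \<le> 5 ^ (t - 1) - 1" "i \<in> {1..2}" "x \<in> ?M (Inl (l, a, i, j))"
        using power_map_near_root.ex_mem_component_half [OF root ec j(2) False]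
        unfolding M by blast
      then show ?thesis using j(1) by (intro disjI2 bexI [of _ "Inl (l, a, i, j)"]) auto
    qed simp
    have sq_in: "x = sqrt_m1 \<or> (\<exists>p\<in>?I <+> ?J. x \<in> ?M p)" if x2: "residue x 1 = 2"
    proof (cases "x = sqrt_m1")
      case False
      obtain l a i where "a \<le> 5 ^ (t - 1) - 1" "i \<in> {1..4}" "x \<in> ?M (Inr (l, a, i))"
        using sq.ex_mem_component [of x] x2 False residue_sqrt_m1 unfolding M' by metis
      then show ?thesis by (intro disjI2 bexI [of _ "Inr (l, a, i)"]) auto
    qed simp
    have msq_in: "x = - sqrt_m1 \<or> (\<exists>p\<in>?I <+> ?J. x \<in> ?M p)" if x3: "residue x 1 = 3"
    proof (cases "x = - sqrt_m1")
      case False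
      have unit: "\<not> 5 dvd x" using x3 by (simp add: five_dvd_iff)
      \<comment> \<open>A point near \<open>- sqrt_m1\<close> is located through its inverse, which
        lies near \<open>sqrt_m1\<close>.\<close>
      have "5 ^ 1 dvd x - (- sqrt_m1)"
        using x3 residue_minus_sqrt_m1 by (simp only: pow5_dvd_diff_iff)
      then have "5 ^ 1 dvd twist 1 x - sqrt_m1"
        using pow5_dvd_twist_diff_iff [of 1 "twist 1 x" sqrt_m1 1] unit sq.unit_c
        by (simp add: twist' twist_twist not_five_dvd_twist)
      moreover have "twist 1 x \<noteq> sqrt_m1"
        using False twist_twist [of 1 x] unit twist' by force
      ultimately obtain l a i where *: "a \<le> 5 ^ (t - 1) - 1" "i \<in> {1..4}" "twist 1 x \<in> coset5 (center sqrt_m1 l a i) (t + l + 1)"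
        using ex_mem_center [of "twist 1 x" sqrt_m1 t] sq.t_ge_1 by auto
      then have "x \<in> ?M (Inr (l, a, i))"
        unfolding M' using unit sq.unit_c by (subst mem_component_iff) auto
      then show ?thesis using * by (intro disjI2 bexI [of _ "Inr (l, a, i)"]) auto
    qed simp
    from units [of 1] units [of 2] sq_in msq_in
    show "x \<in> {0, 1, -1, sqrt_m1, - sqrt_m1} \<or> (\<exists>p\<in>?I <+> ?J. x \<in> ?M p) \<or> x \<in> coset5 0 1 - {0}"
      unfolding res_c mem_coset5_1_iff Diff_iff residue_0_1
      by (cases x rule: residue_1_cases) (simp_all split del: if_split, blast+)
  next
    have "sqrt_m1 \<in> periodic_points ?f" "- sqrt_m1 \<in> periodic_points ?f"
      unfolding periodic_points_def by (auto simp: numeral_2_eq_2 swap intro!: exI [of _ 2])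
    then show "{0, 1, -1, sqrt_m1, - sqrt_m1} \<subseteq> periodic_points ?f"
      using fixed_point_periodic(1) [of ?f 0] fixed_point_periodic(1) [of ?f, OF fixed [of 1]]
        fixed_point_periodic(1) [of ?f, OF fixed [of 2]] m
      by (simp add: zero_power)
  next
    show "(coset5 0 1 - {0}) \<inter> periodic_points ?f = {}"
      by (rule no_periodic_points_in_0_ball [OF m(1)])
  next
    fix p
    assume p: "p \<in> ?I <+> ?J"
    show "minimal_component ?f (?M p)"
    proof (cases p)
      case (Inl p')
      obtain l a i j where p_eq: "p' = (l, a, i, j)" by (cases p')
      have "i \<in> {1..4}" using p Inl p_eq by auto
      then show ?thesis
        unfolding Inl p_eq M by (rule power_map_near_root.component_minimal [OF root])
    next
      case (Inr p')
      obtain l a i where p_eq: "p' = (l, a, i)" by (cases p')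
      have "i \<in> {1..4}" using p Inr p_eq by auto
      then show ?thesis unfolding Inr p_eq M' by (rule sq.component_minimal)
    qed
    fix x assume x: "x \<in> ?M p"
    show "x \<notin> coset5 0 1 - {0}"
    proof (cases p)
      case (Inl p')
      obtain l a i j where p_eq: "p' = (l, a, i, j)" by (cases p')
      show ?thesis using res [OF x [unfolded Inl p_eq]]
        by (simp add: mem_coset5_1_iff residue_0_1 split: if_splits)
    next
      case (Inr p')
      obtain l a i where p_eq: "p' = (l, a, i)" by (cases p')
      show ?thesis using res' [OF x [unfolded Inr p_eq]]
        by (auto simp add: mem_coset5_1_iff residue_0_1)
    qed
    fix q
    assume q: "q \<in> ?I <+> ?J" "x \<in> ?M q"
    show "p = q"
    proof (cases p; cases q)
      fix p' q' assume eq: "p = Inl p'" "q = Inl q'"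
      obtain l a i j where p_eq: "p' = (l, a, i, j)" by (cases p')
      obtain l' a' i' j' where q_eq: "q' = (l', a', i', j')" by (cases q')
      have pI: "a \<le> 5 ^ (t - 1) - 1" "i \<in> {1..2}" "j \<in> {1..2}" using p eq p_eq by auto
      have qI: "a' \<le> 5 ^ (t - 1) - 1" "i' \<in> {1..2}" "j' \<in> {1..2}" using q(1) eq q_eq by auto
      have jj: "j = j'"
        using res [OF x [unfolded eq p_eq]] res [OF q(2) [unfolded eq q_eq]] pI(3) qI(3)
        by (auto split: if_splits)
      have "x \<in> component 1 (?c j) t l' a' i'" using q(2) unfolding eq q_eq M jj .
      with x show ?thesis
        using power_map_near_root.component_unique_half [OF root ec] pI qI
        unfolding eq p_eq q_eq jj M by blast
    next
      fix p' q' assume eq: "p = Inr p'" "q = Inr q'"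
      obtain l a i where p_eq: "p' = (l, a, i)" by (cases p')
      obtain l' a' i' where q_eq: "q' = (l', a', i')" by (cases q')
      have pI: "a \<le> 5 ^ (t - 1) - 1" "i \<in> {1..4}" using p eq p_eq by auto
      have qI: "a' \<le> 5 ^ (t - 1) - 1" "i' \<in> {1..4}" using q(1) eq q_eq by auto
      show ?thesis
        using sq.component_unique_full [OF sq2 x [unfolded eq p_eq M'] q(2) [unfolded eq q_eq M']
            pI(2) qI(2) pI(1) qI(1)] eq p_eq q_eq by simp
    next
      \<comment> \<open>Components of different kinds are disjoint because their residues modulo
        \<open>5\<close> are \<open>1\<close> or \<open>4\<close> for one kind and \<open>2\<close>
        or \<open>3\<close> for the other.\<close>
      fix p' q' assume eq: "p = Inl p'" "q = Inr q'"
      obtain l a i j where p_eq: "p' = (l, a, i, j)" by (cases p')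
      obtain l' a' i' where q_eq: "q' = (l', a', i')" by (cases q')
      show ?thesis
        using res [OF x [unfolded eq p_eq]] res' [OF q(2) [unfolded eq q_eq]] by (auto split: if_splits)
    next
      fix p' q' assume eq: "p = Inr p'" "q = Inl q'"
      obtain l a i where p_eq: "p' = (l, a, i)" by (cases p')
      obtain l' a' i' j' where q_eq: "q' = (l', a', i', j')" by (cases q')
      show ?thesis
        using res' [OF x [unfolded eq p_eq]] res [OF q(2) [unfolded eq q_eq]] by (auto split: if_splits)
    qed
  next
    fix x assume "x \<in> coset5 0 1 - {0}"
    then show "(\<exists>n A. periodic_orbit ?f n A \<and> x \<in> attracting_basin ?f A) \<or>
      (\<exists>p\<in>?I <+> ?J. x \<in> attracting_basin ?f (?M p))"
      using basin_0 [OF m(1)] by blast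
  qed simp
qed

theorem theorem5p5:
  fixes m t :: nat and f :: "padic5 \<Rightarrow> padic5"
  assumes "m \<ge> 2" and "[int m = -1] (mod 5)"
    and "f = (\<lambda>x. x ^ m)"
    and "t = multiplicity 5 (m + 1)"
  shows
    "([m = 4] (mod 10) \<longrightarrow>
        minimal_decomposition f
          {0, 1}
          (UNIV \<times> {..5 ^ (t - 1) - 1} \<times> {1..2})
          (\<lambda>(l, a, i). comp_inv 1 t l a i)
          ((coset5 0 1 - {0}) \<union> coset5 2 1 \<union> coset5 3 1 \<union> coset5 4 1)
        \<and> f 0 = 0 \<and> f 1 = 1
        \<and> attracting_basin f {0} - {0} = coset5 0 1 - {0}
        \<and> attracting_basin f (coset5 1 1) - coset5 1 1 = coset5 2 1 \<union> coset5 3 1 \<union> coset5 4 1)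
   \<and> ([m = 9] (mod 20) \<longrightarrow>
        minimal_decomposition f
          {0, 1, -1, sqrt_m1, - sqrt_m1}
          (UNIV \<times> {..5 ^ (t - 1) - 1} \<times> {1..2} \<times> {1..4})
          (\<lambda>(l, a, i, j :: nat).
             if j = 1 then comp_inv 1 t l a i
             else if j = 2 then comp_inv (-1) t l a i
             else if j = 3 then comp_neg_inv sqrt_m1 t l a i
             else comp_neg_inv (- sqrt_m1) t l a i)
          (coset5 0 1 - {0})
        \<and> f 0 = 0 \<and> f 1 = 1 \<and> f (-1) = -1 \<and> f sqrt_m1 = sqrt_m1 \<and> f (- sqrt_m1) = - sqrt_m1
        \<and> attracting_basin f {0} - {0} = coset5 0 1 - {0})
   \<and> ([m = 19] (mod 20) \<longrightarrow>
        minimal_decomposition f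
          {0, 1, -1, sqrt_m1, - sqrt_m1}
          ((UNIV \<times> {..5 ^ (t - 1) - 1} \<times> {1..2} \<times> {1..2}) <+>
           (UNIV \<times> {..5 ^ (t - 1) - 1} \<times> {1..4}))
          (case_sum
             (\<lambda>(l, a, i, j :: nat). if j = 1 then comp_inv 1 t l a i else comp_inv (-1) t l a i)
             (\<lambda>(l, a, i). comp_inv sqrt_m1 t l a i))
          (coset5 0 1 - {0})
        \<and> f 0 = 0 \<and> f 1 = 1 \<and> f (-1) = -1
        \<and> periodic_orbit f 2 {sqrt_m1, - sqrt_m1}
        \<and> attracting_basin f {0} - {0} = coset5 0 1 - {0})"
proof (intro conjI impI)
  have m: "m \<ge> 2" "5 dvd m + 1"
  proof -
    have "5 dvd int m + 1" using assms(2) by (simp add: cong_iff_dvd_diff)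
    then show "5 dvd m + 1" by presburger
  qed fact
  note f = assms(3) and t = assms(4)
  have basin: "attracting_basin f {0} - {0} = coset5 0 1 - {0}"
    by (simp only: f attracting_basin_power_map_0 [OF m(1)])
  then show "attracting_basin f {0} - {0} = coset5 0 1 - {0}"
    "attracting_basin f {0} - {0} = coset5 0 1 - {0}"
    "attracting_basin f {0} - {0} = coset5 0 1 - {0}"
    by assumption+
  show "f 0 = 0" "f 0 = 0" "f 0 = 0" "f 1 = 1" "f 1 = 1" "f 1 = 1"
    using m(1) by (simp_all add: f zero_power)
  \<comment> \<open>Given \<open>5 dvd m + 1\<close>, the three cases are distinguished by the
    parity of \<open>m\<close> and, for odd \<open>m\<close>, by whether \<open>4\<close> divides
    \<open>m + 1\<close>.\<close>
  {
    assume "[m = 4] (mod 10)"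
    then have "[m = 4] (mod 2)" by (rule cong_dvd_modulus_nat) simp
    then have "even m" by (simp add: cong_def even_iff_mod_2_eq_zero)
    from power_map_even_case [OF m t this]
    show "minimal_decomposition f {0, 1} (UNIV \<times> {..5 ^ (t - 1) - 1} \<times> {1..2})
          (\<lambda>(l, a, i). comp_inv 1 t l a i)
          ((coset5 0 1 - {0}) \<union> coset5 2 1 \<union> coset5 3 1 \<union> coset5 4 1)"
      "attracting_basin f (coset5 1 1) - coset5 1 1 = coset5 2 1 \<union> coset5 3 1 \<union> coset5 4 1"
      unfolding f .
  next
    assume "[m = 9] (mod 20)"
    then have "[m = 9] (mod 4)" by (rule cong_dvd_modulus_nat) simp
    then have "m mod 4 = 1" by (simp add: cong_def)
    then have odd: "odd m" "\<not> 4 dvd m + 1" by presburger+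
    from power_map_odd_2_mod_4_case [OF m t odd] odd(1)
    show "minimal_decomposition f {0, 1, -1, sqrt_m1, - sqrt_m1}
          (UNIV \<times> {..5 ^ (t - 1) - 1} \<times> {1..2} \<times> {1..4})
          (\<lambda>(l, a, i, j :: nat).
             if j = 1 then comp_inv 1 t l a i
             else if j = 2 then comp_inv (-1) t l a i
             else if j = 3 then comp_neg_inv sqrt_m1 t l a i
             else comp_neg_inv (- sqrt_m1) t l a i)
          (coset5 0 1 - {0})" "f (-1) = -1" "f sqrt_m1 = sqrt_m1" "f (- sqrt_m1) = - sqrt_m1"
      unfolding f by simp_all
  next
    assume "[m = 19] (mod 20)"
    then have "[m = 19] (mod 4)" by (rule cong_dvd_modulus_nat) simp
    then have "m mod 4 = 3" by (simp add: cong_def)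
    then have odd: "odd m" "4 dvd m + 1" by presburger+
    from power_map_odd_0_mod_4_case [OF m t odd] odd(1)
    show "minimal_decomposition f {0, 1, -1, sqrt_m1, - sqrt_m1}
          ((UNIV \<times> {..5 ^ (t - 1) - 1} \<times> {1..2} \<times> {1..2}) <+>
           (UNIV \<times> {..5 ^ (t - 1) - 1} \<times> {1..4}))
          (case_sum
             (\<lambda>(l, a, i, j :: nat). if j = 1 then comp_inv 1 t l a i else comp_inv (-1) t l a i)
             (\<lambda>(l, a, i). comp_inv sqrt_m1 t l a i))
          (coset5 0 1 - {0})" "f (-1) = -1" "periodic_orbit f 2 {sqrt_m1, - sqrt_m1}"
      unfolding f by simp_all
  }
qed

end
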